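(* Let $n,d\geq 1$ and $k\geq 2$ be integers, and let $\mu_1,\ldots,\mu_n$ be a collection of $n$ continuous probability measures on the $d$-dimensional cube $I^d=[0,1]^d\subset\mathbb{R}^d$. Let $m_1,\ldots,m_d$ be any non-negative integers such that $m_1+\cdots+m_d=n(k-1)$. Then there exists a set $\mathcal{X}=\bigcup_{i=1}^d\mathcal{X}_i$ of $n(k-1)$ hyperplanes such that $\vert\mathcal{X}_i\vert=m_i$ for each $i$, each $H\in\mathcal{X}_i$ is perpendicular to $e_i$, and such that for some coloring function $\omega:C(\mathcal{X})\rightarrow[k]$ $$\mu_i(A_j)=\frac{1}{k}\quad\text{for all } i=1,\ldots,n \text{ and } j=1,\ldots,k,$$ where $A_j:=\bigcup\omega^{-1}(j)$ is the union of all cells colored by the color $j$.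
   Context: $e_1,\ldots,e_d$ is the standard basis of $\mathbb{R}^d$, and $[k]=\{1,\ldots,k\}$. Hyperplanes are affine hyperplanes of $\mathbb{R}^d$ cutting (i.e. meeting) the cube $I^d$. For a finite set $\mathcal{X}$ of hyperplanes, $C(\mathcal{X})$ is the set of cells, i.e. connected components, of $I^d\setminus\bigcup\mathcal{X}$. A probability measure on $I^d$ is called continuous if it is given by a density function with respect to Lebesgue measure $m$, i.e. $d\mu=f\cdot dm$. *)

theory Defs
  imports "HOL-Probability.Probability"
begin

definition unit_cube :: "(real ^ 'd) set" where
  "unit_cube = cbox 0 1"

lemma mem_unit_cube: "x \<in> unit_cube \<longleftrightarrow> (\<forall>i. 0 \<le> x $ i \<and> x $ i \<le> 1)"
  by (simp add: unit_cube_def mem_box_cart)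

text \<open>The underlying sigma-algebra consists of the Lebesgue measurable subsets of the cube.\<close>

definition continuous_prob_measure :: "(real ^ 'd) measure \<Rightarrow> bool" where
  "continuous_prob_measure M \<longleftrightarrow> prob_space M \<and>
    (\<exists>f :: real ^ 'd \<Rightarrow> real.
       f \<in> borel_measurable (lebesgue_on unit_cube) \<and> (\<forall>x\<in>unit_cube. 0 \<le> f x) \<and>
       M = density (lebesgue_on unit_cube) (\<lambda>x. ennreal (f x)))"

definition hyperplane :: "(real ^ 'd) set \<Rightarrow> bool" where
  "hyperplane H \<longleftrightarrow> (\<exists>a b. a \<noteq> 0 \<and> H = {x. a \<bullet> x = b})"

definition perpendicular :: "(real ^ 'd) set \<Rightarrow> real ^ 'd \<Rightarrow> bool" where
  "perpendicular H v \<longleftrightarrow> (\<forall>x\<in>H. \<forall>y\<in>H. orthogonal (x - y) v)"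

definition cells :: "(real ^ 'd) set set \<Rightarrow> (real ^ 'd) set set" where
  "cells X = components (unit_cube - \<Union>X)"

definition colored_region ::
  "(real ^ 'd) set set \<Rightarrow> ((real ^ 'd) set \<Rightarrow> nat) \<Rightarrow> nat \<Rightarrow> (real ^ 'd) set" where
  "colored_region X \<omega> j = \<Union>{c \<in> cells X. \<omega> c = j}"

end

theory Submission
  imports Defs "HOL-Library.Poly_Mapping" "HOL-Number_Theory.Cong" "HOL-Computational_Algebra.Primes"
begin

text \<open>
  Since a colour class of a splitting into \<open>p\<close> parts can be split further into \<open>q\<close> parts, and
  \<open>n (p - 1) + p n (q - 1) = n (p q - 1)\<close>, it suffices to treat a prime \<open>p\<close>; for this induction signed
  densities are as good as measures. Let \<open>N = n (p - 1)\<close> and fix any sequence of \<open>N\<close> directions with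
  the prescribed multiplicities. Cutting the remaining part of the cube successively
  perpendicularly to these directions yields \<open>N + 1\<close> pieces, whose positions are governed by a point of
  the simplex with vertices \<open>0, \<dots>, N\<close> such that a piece of weight zero is a null set.
  Hence the pairs of a cutting and a colouring of its pieces form the \<open>N\<close>-dimensional
  join of \<open>N + 1\<close> copies of the cyclic group of order \<open>p\<close>, on which the measures of the colour
  classes are continuous and equivariant.

  If no point were balanced, then labelling each point with a measure and a colour for which the
  excess over the mean is maximal would give, on a fine subdivision, an equivariant
  simplicial map into an \<open>(N - 1)\<close>-dimensional complex with free action. This is impossible: on the
  labels one constructs cochains of increasing degree, and the chains
  of a resolution of the cyclic group that live in the join pair with them to a
  value that is \<open>\<plusminus> 1\<close> modulo \<open>p\<close> in every even degree.
\<close>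

section \<open>Chains of lists\<close>

text \<open>The non-existence used here is that of an equivariant map from a highly connected
  complex to a free complex of smaller dimension, made explicit on chains and cochains. The obstacle
  is freeness. The labels on a small simplex omit a colour for every measure, so they span a simplex
  of the join of \<open>n\<close> boundaries of \<open>(p - 1)\<close>-simplices. For prime
  \<open>p\<close> a nonempty proper set of colours has a mean modulo \<open>p\<close>, which moves
  by 1 under the cyclic shift; for composite \<open>p\<close> some such sets are invariant under
  part of the group. Raising the degree of cochains by two is the periodicity of the cohomology of a
  cyclic group, and each such step changes the sign of the value modulo \<open>p\<close>, hence the
  \<plusminus> 1. Simplices are lists that may repeat vertices; since all cochains are alternating,
  a chain of label lists that all have repetitions pairs to zero.\<close>

type_synonym 'a frag = "'a \<Rightarrow>\<^sub>0 int"

definition cone_chain :: "'a \<Rightarrow> 'a list frag \<Rightarrow> 'a list frag" where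
  "cone_chain v = frag_extend (\<lambda>xs. frag_of (v # xs))"

text \<open>The list \<open>[]\<close> serves as the simplex of degree -1: the complex is augmented,
  the boundary of a vertex is \<open>[]\<close>, and the cone formula \<open>Boundary_cone\<close>
  holds in every degree without exception.\<close>

primrec boundary :: "'a list \<Rightarrow> 'a list frag" where
  "boundary [] = 0"
| "boundary (x # xs) = frag_of xs - cone_chain x (boundary xs)"

abbreviation Boundary :: "'a list frag \<Rightarrow> 'a list frag" where
  "Boundary \<equiv> frag_extend boundary"

abbreviation map_chain :: "('a \<Rightarrow> 'b) \<Rightarrow> 'a list frag \<Rightarrow> 'b list frag" where
  "map_chain f \<equiv> frag_extend (\<lambda>xs. frag_of (map f xs))"

lemma cone_diff: "cone_chain v (a - b) = cone_chain v a - cone_chain v b"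
  by (simp add: cone_chain_def frag_extend_diff)

lemma cone_0 [simp]: "cone_chain v 0 = 0"
  by (simp add: cone_chain_def)

lemma cone_of: "cone_chain v (frag_of xs) = frag_of (v # xs)"
  by (simp add: cone_chain_def)

lemma frag_extend_extend:
  "frag_extend f (frag_extend g c) = frag_extend (\<lambda>x. frag_extend f (g x)) c"
proof -
  have "Poly_Mapping.keys c \<subseteq> UNIV" by simp
  then show ?thesis
    by (induction c rule: frag_induction) (auto simp: frag_extend_diff)
qed

lemma frag_extend_id [simp]: "frag_extend frag_of c = c"
  by (simp flip: frag_expansion)

lemma Boundary_cone: "Boundary (cone_chain v c) = c - cone_chain v (Boundary c)"
proof -
  have "Poly_Mapping.keys c \<subseteq> UNIV" by simp
  then show ?thesis
    by (induction c rule: frag_induction)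
      (auto simp: frag_extend_diff cone_diff cone_of)
qed

lemma Boundary_boundary: "Boundary (boundary xs) = 0"
  by (induction xs) (auto simp: frag_extend_diff Boundary_cone)

lemma map_chain_cone: "map_chain f (cone_chain v c) = cone_chain (f v) (map_chain f c)"
  by (simp add: cone_chain_def frag_extend_extend)

lemma boundary_map: "boundary (map f xs) = map_chain f (boundary xs)"
  by (induction xs) (auto simp: frag_extend_diff map_chain_cone)

lemma Boundary_map_chain: "Boundary (map_chain f c) = map_chain f (Boundary c)"
  by (simp add: frag_extend_extend boundary_map)

lemma map_chain_map_chain: "map_chain f (map_chain g c) = map_chain (f \<circ> g) c"
  by (simp add: frag_extend_extend)

lemma keys_cone: "Poly_Mapping.keys (cone_chain v c) \<subseteq> (#) v ` Poly_Mapping.keys c"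
  unfolding cone_chain_def by (rule order_trans[OF keys_frag_extend]) auto

lemma keys_boundary:
  "ys \<in> Poly_Mapping.keys (boundary xs) \<Longrightarrow> set ys \<subseteq> set xs \<and> Suc (length ys) = length xs"
proof (induction xs arbitrary: ys)
  case (Cons x xs)
  have "ys = xs \<or> ys \<in> (#) x ` Poly_Mapping.keys (boundary xs)"
    using Cons.prems keys_diff[of "frag_of xs" "cone_chain x (boundary xs)"] keys_cone[of x "boundary xs"]
    by (auto split: if_splits)
  then show ?case
  proof
    assume "ys \<in> (#) x ` Poly_Mapping.keys (boundary xs)"
    then obtain zs where "zs \<in> Poly_Mapping.keys (boundary xs)" "ys = x # zs" by blast
    then show ?thesis using Cons.IH[of zs] by auto
  qed auto
qed simp

lemma keys_map_chain: "Poly_Mapping.keys (map_chain f c) \<subseteq> map f ` Poly_Mapping.keys c"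
  by (rule order_trans[OF keys_frag_extend]) auto

section \<open>Pairing cochains with chains; alternating cochains\<close>

definition pairing :: "('a \<Rightarrow> int) \<Rightarrow> 'a frag \<Rightarrow> int" where
  "pairing e c = (\<Sum>x\<in>Poly_Mapping.keys c. Poly_Mapping.lookup c x * e x)"

lemma pairing_superset:
  assumes "finite A" "Poly_Mapping.keys c \<subseteq> A"
  shows "pairing e c = (\<Sum>x\<in>A. Poly_Mapping.lookup c x * e x)"
  unfolding pairing_def using assms
  by (intro sum.mono_neutral_left) (auto simp: in_keys_iff)

lemma pairing_0 [simp]: "pairing e 0 = 0"
  by (simp add: pairing_def)

lemma pairing_of [simp]: "pairing e (frag_of x) = e x"
  by (simp add: pairing_def)

lemma pairing_diff: "pairing e (a - b) = pairing e a - pairing e b"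
proof -
  let ?A = "Poly_Mapping.keys a \<union> Poly_Mapping.keys b"
  have "pairing e c = (\<Sum>x\<in>?A. Poly_Mapping.lookup c x * e x)"
    if "Poly_Mapping.keys c \<subseteq> ?A" for c
    using that by (intro pairing_superset) auto
  then show ?thesis
    using keys_diff[of a b] by (simp add: lookup_minus left_diff_distrib sum_subtractf)
qed

lemma pairing_add: "pairing e (a + b) = pairing e a + pairing e b"
  using pairing_diff[of e a "- b"] pairing_diff[of e 0 b] by simp

lemma pairing_sum: "pairing e (sum f A) = (\<Sum>x\<in>A. pairing e (f x))"
  by (induction A rule: infinite_finite_induct) (auto simp: pairing_add)

lemma pairing_extend: "pairing e (frag_extend f c) = pairing (\<lambda>x. pairing e (f x)) c"
proof -
  have "Poly_Mapping.keys c \<subseteq> UNIV" by simp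
  then show ?thesis
    by (induction c rule: frag_induction) (auto simp: frag_extend_diff pairing_diff)
qed

lemma pairing_map_chain: "pairing e (map_chain f c) = pairing (\<lambda>xs. e (map f xs)) c"
  by (simp add: pairing_extend)

lemma pairing_cong: "(\<And>x. x \<in> Poly_Mapping.keys c \<Longrightarrow> e x = e' x) \<Longrightarrow> pairing e c = pairing e' c"
  by (simp add: pairing_def)

lemma pairing_fun_diff: "pairing (\<lambda>x. e x - e' x) c = pairing e c - pairing e' c"
  by (simp add: pairing_def sum_subtractf right_diff_distrib)

lemma pairing_fun_mult: "pairing (\<lambda>x. k * e x) c = k * pairing e c"
  by (simp add: pairing_def sum_distrib_left mult_ac)

lemma pairing_fun_sum: "pairing (\<lambda>x. \<Sum>m\<in>A. e m x) c = (\<Sum>m\<in>A. pairing (e m) c)"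
  unfolding pairing_def by (simp add: sum_distrib_left) (rule sum.swap)

lemma pairing_fun_uminus: "pairing (\<lambda>x. - e x) c = - pairing e c"
  using pairing_fun_mult[of "-1" e c] by simp

text \<open>Chains keep lists with repeated vertices. Degeneracy is imposed on the cochains instead:
  an alternating one vanishes on every list that is not distinct, and this is what the final
  contradiction uses.\<close>

definition alternating :: "('a list \<Rightarrow> int) \<Rightarrow> bool" where
  "alternating e \<longleftrightarrow> (\<forall>us a b vs. e (us @ a # b # vs) = - e (us @ b # a # vs)) \<and>
     (\<forall>us a vs. e (us @ a # a # vs) = 0)"

abbreviation coboundary :: "('a list \<Rightarrow> int) \<Rightarrow> 'a list \<Rightarrow> int" where
  "coboundary e \<equiv> \<lambda>xs. pairing e (boundary xs)"

lemma pairing_cone: "pairing e (cone_chain x c) = pairing (\<lambda>ys. e (x # ys)) c"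
  by (simp add: cone_chain_def pairing_extend)

lemma alternating_swap: "alternating e \<Longrightarrow> e (us @ a # b # vs) = - e (us @ b # a # vs)"
  unfolding alternating_def by blast

lemma alternating_repeat: "alternating e \<Longrightarrow> e (us @ a # a # vs) = 0"
  unfolding alternating_def by blast

lemma alternating_Cons:
  assumes e: "alternating e"
  shows "alternating (\<lambda>ys. e (x # ys))"
proof (unfold alternating_def, intro conjI allI)
  show "e (x # us @ a # b # vs) = - e (x # us @ b # a # vs)" for us a b vs
    using alternating_swap[OF e, of "x # us" a b vs] by simp
  show "e (x # us @ a # a # vs) = 0" for us a vs
    using alternating_repeat[OF e, of "x # us" a vs] by simp
qed

text \<open>The faces omitting \<open>a\<close> and \<open>b\<close> are exchanged with opposite
  signs, and the later faces contain both. A common prefix is absorbed one vertex \<open>u\<close>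
  at a time by passing to \<open>\<lambda>ys. e (u # ys)\<close>, hence the induction generalises
  over \<open>e\<close>.\<close>

lemma alternating_coboundary:
  assumes "alternating e"
  shows "alternating (coboundary e)"
proof -
  have "coboundary e (us @ a # b # vs) = - coboundary e (us @ b # a # vs) \<and> coboundary e (us @ a # a # vs) = 0"
    for us vs and a b :: 'a
    using assms
  proof (induction us arbitrary: e)
    case Nil
    have "(\<lambda>ys. e (a # b # ys)) = (\<lambda>ys. - e (b # a # ys))" "(\<lambda>ys. e (a # a # ys)) = (\<lambda>ys. 0 * e ys)"
      using alternating_swap[OF Nil, of "[]" a b] alternating_repeat[OF Nil, of "[]" a]
      by (auto intro!: ext)
    then show ?case
      by (simp add: pairing_diff pairing_cone cone_diff cone_of pairing_fun_uminus pairing_fun_mult del: mult_zero_left)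
  next
    case (Cons u us)
    then show ?case
      using Cons.IH[OF alternating_Cons[OF Cons.prems, of u]]
        alternating_swap[OF Cons.prems, of us a b vs] alternating_repeat[OF Cons.prems, of us a vs]
      by (simp add: pairing_diff pairing_cone)
  qed
  then show ?thesis unfolding alternating_def by blast
qed

lemma alternating_not_distinct:
  assumes "alternating e" "\<not> distinct xs"
  shows "e xs = 0"
proof -
  have *: "e (us @ a # ws @ a # vs) = 0" for us a ws vs
  proof (induction ws arbitrary: us)
    case Nil
    then show ?case using alternating_repeat[OF assms(1)] by simp
  next
    case (Cons w ws)
    have "e (us @ a # w # ws @ a # vs) = - e (us @ w # a # ws @ a # vs)"
      by (rule alternating_swap[OF assms(1)])
    also have "\<dots> = 0" using Cons[of "us @ [w]"] by simp
    finally show ?case by simp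
  qed
  obtain us a ws vs where "xs = us @ [a] @ ws @ [a] @ vs"
    using not_distinct_decomp[OF assms(2)] by blast
  then show ?thesis using * by simp
qed

section \<open>Cochains on freely permuted labels\<close>

text \<open>If \<open>t q = t 0\<close>, this determines the sum of \<open>t\<close> over a period
  modulo \<open>q\<close> from the differences of \<open>t\<close> alone.\<close>

lemma sum_by_parts:
  fixes t :: "nat \<Rightarrow> int"
  shows "(\<Sum>m<q. int m * (t m - t (Suc m))) = (\<Sum>m<q. t m) + t q - t 0 - int q * t q"
  by (induction q) (simp_all add: algebra_simps)

lemma funpow_image_Suc: "(g ^^ Suc m) ` S = g ` ((g ^^ m) ` S)"
  by auto

lemma map_funpow_Suc: "map g (map (g ^^ m) xs) = map (g ^^ Suc m) xs"
  by simp

lemma add_mod_eq_0_iff: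
  fixes a m p :: nat
  assumes "a < p" "m < p"
  shows "(a + m) mod p = 0 \<longleftrightarrow> m = (p - a) mod p"
proof (cases "a + m < p")
  case True
  then show ?thesis using assms by (cases "a = 0") auto
next
  case False
  then have "(a + m) mod p = a + m - p" using assms by (simp add: le_mod_geq)
  then show ?thesis using assms False by (cases "a = 0") auto
qed

text \<open>Each passage up by two degrees turns the value \<open>b\<close> into \<open>- b\<close>
  modulo \<open>q\<close>, so both signs are carried along together.\<close>

lemma dvd_add_minus_one:
  fixes a b q :: int
  assumes "q dvd a + b" "q dvd b - 1 \<or> q dvd b + 1"
  shows "q dvd a - 1 \<or> q dvd a + 1"
  using assms(2)
proof
  assume "q dvd b - 1"
  from dvd_diff[OF assms(1) this] show ?thesis by simp
next
  assume "q dvd b + 1"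
  from dvd_diff[OF assms(1) this] show ?thesis by simp
qed

text \<open>\<open>good\<close> singles out the simplices of the label complex. An equivariant
  \<open>\<alpha>\<close> on the nonempty ones expresses that the cyclic group permutes them freely,
  and \<open>\<alpha> S = 0\<close> picks one simplex from each orbit.\<close>

locale free_cyclic_labels =
  fixes p :: nat and g :: "'l \<Rightarrow> 'l" and good :: "'l set \<Rightarrow> bool" and \<alpha> :: "'l set \<Rightarrow> nat"
  assumes p: "2 \<le> p"
    and period: "g ^^ p = id"
    and good_image: "good S \<Longrightarrow> good (g ` S)"
    and good_subset: "good S \<Longrightarrow> T \<subseteq> S \<Longrightarrow> good T"
    and \<alpha>_less: "\<alpha> S < p"
    and \<alpha>_image: "good S \<Longrightarrow> S \<noteq> {} \<Longrightarrow> \<alpha> (g ` S) = Suc (\<alpha> S) mod p"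
begin

text \<open>Cochains are functions on all lists, so invariance and the cocycle condition are
  demanded only on lists of the right length that span good sets.\<close>

definition invariant_cocycle :: "nat \<Rightarrow> ('l list \<Rightarrow> int) \<Rightarrow> bool" where
  "invariant_cocycle k z \<longleftrightarrow> alternating z \<and>
     (\<forall>xs. good (set xs) \<longrightarrow> length xs = Suc k \<longrightarrow> z (map g xs) = z xs) \<and>
     (\<forall>xs. good (set xs) \<longrightarrow> length xs = Suc (Suc k) \<longrightarrow> coboundary z xs = 0)"

text \<open>An invariant cochain \<open>z\<close> is the sum of the translates of \<open>restr z\<close>, and the coboundary of \<open>restr z\<close>
  is \<open>transfer z - transfer z \<circ> g\<close>. The coboundary of \<open>transfer z\<close> is again an invariant cocycle, in degree
  two higher.\<close>

definition restr :: "('l list \<Rightarrow> int) \<Rightarrow> 'l list \<Rightarrow> int" where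
  "restr z xs = (if \<alpha> (set xs) = 0 then z xs else 0)"

definition transfer :: "('l list \<Rightarrow> int) \<Rightarrow> 'l list \<Rightarrow> int" where
  "transfer z xs = (\<Sum>m<p - \<alpha> (set xs). coboundary (restr z) (map (g ^^ m) xs))"

lemma good_funpow: "good S \<Longrightarrow> good ((g ^^ m) ` S)"
  by (induction m) (simp, metis funpow_image_Suc good_image)

lemma alpha_funpow:
  assumes "good S" "S \<noteq> {}"
  shows "\<alpha> ((g ^^ m) ` S) = (\<alpha> S + m) mod p"
proof (induction m)
  case 0
  then show ?case using \<alpha>_less[of S] by simp
next
  case (Suc m)
  show ?case unfolding funpow_image_Suc
    using \<alpha>_image[OF good_funpow[OF assms(1), of m]] assms(2) Suc by (simp add: mod_simps)
qed

text \<open>The index \<open>\<alpha>\<close> is read off from the set of vertices, hence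
  insensitive to their order.\<close>

lemma alternating_restr:
  assumes "alternating z"
  shows "alternating (restr z)"
  unfolding alternating_def restr_def
proof (intro conjI allI)
  fix us vs and a b :: 'l
  have *: "set (us @ a # b # vs) = set (us @ b # a # vs)" by auto
  show "(if \<alpha> (set (us @ a # b # vs)) = 0 then z (us @ a # b # vs) else 0) =
      - (if \<alpha> (set (us @ b # a # vs)) = 0 then z (us @ b # a # vs) else 0)"
    unfolding * alternating_swap[OF assms, of us a b vs] by simp
  show "(if \<alpha> (set (us @ a # a # vs)) = 0 then z (us @ a # a # vs) else 0) = 0"
    unfolding alternating_repeat[OF assms] by simp
qed

lemma alternating_transfer:
  assumes "alternating z"
  shows "alternating (transfer z)"
proof -
  have y: "alternating (coboundary (restr z))"
    by (rule alternating_coboundary[OF alternating_restr[OF assms]])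
  show ?thesis
    unfolding alternating_def transfer_def
  proof (intro conjI allI)
    fix us vs and a b :: 'l
    have *: "set (us @ a # b # vs) = set (us @ b # a # vs)" by auto
    show "(\<Sum>m<p - \<alpha> (set (us @ a # b # vs)). coboundary (restr z) (map (g ^^ m) (us @ a # b # vs))) =
        - (\<Sum>m<p - \<alpha> (set (us @ b # a # vs)). coboundary (restr z) (map (g ^^ m) (us @ b # a # vs)))"
      unfolding * sum_negf[symmetric] map_append list.map
      by (rule sum.cong[OF refl alternating_swap[OF y]])
    show "(\<Sum>m<p - \<alpha> (set (us @ a # a # vs)). coboundary (restr z) (map (g ^^ m) (us @ a # a # vs))) = 0"
      unfolding map_append list.map
      by (rule sum.neutral, rule ballI, rule alternating_repeat[OF y])
  qed
qed

text \<open>The translates of a good simplex run through all indices modulo \<open>p\<close>, so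
  exactly one of them, the \<open>m0\<close>-th, is seen by \<open>restr z\<close>.\<close>

lemma sum_restr:
  assumes z: "invariant_cocycle k z" and xs: "good (set xs)" "length xs = Suc k"
  shows "(\<Sum>m<p. restr z (map (g ^^ m) xs)) = z xs"
proof -
  have ne: "set xs \<noteq> {}" using xs by auto
  have inv: "z (map (g ^^ m) xs) = z xs" for m
  proof (induction m)
    case (Suc m)
    have "z (map g (map (g ^^ m) xs)) = z (map (g ^^ m) xs)"
      using z xs good_funpow[OF xs(1), of m] unfolding invariant_cocycle_def
      by (simp del: map_map)
    then show ?case using Suc unfolding map_funpow_Suc by (simp only:)
  qed simp
  define m0 where "m0 = (p - \<alpha> (set xs)) mod p"
  have m0: "m0 < p" using p by (simp add: m0_def)
  have "((\<alpha> (set xs) + m) mod p = 0) = (m = m0)" if "m < p" for m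
    unfolding m0_def by (rule add_mod_eq_0_iff[OF \<alpha>_less that])
  then have "(\<Sum>m<p. restr z (map (g ^^ m) xs)) = (\<Sum>m<p. if m = m0 then z xs else 0)"
    using alpha_funpow[OF xs(1) ne] inv by (intro sum.cong) (auto simp: restr_def)
  then show ?thesis using m0 by simp
qed

lemma sum_coboundary_restr:
  assumes z: "invariant_cocycle k z" and xs: "good (set xs)" "length xs = Suc (Suc k)"
  shows "(\<Sum>m<p. coboundary (restr z) (map (g ^^ m) xs)) = 0"
proof -
  have "(\<Sum>m<p. coboundary (restr z) (map (g ^^ m) xs)) = pairing (\<lambda>ys. \<Sum>m<p. restr z (map (g ^^ m) ys)) (boundary xs)"
    by (simp add: boundary_map pairing_map_chain pairing_fun_sum)
  also have "\<dots> = pairing z (boundary xs)"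
    using keys_boundary[of _ xs] xs good_subset[OF xs(1)]
    by (intro pairing_cong sum_restr[OF z]) auto
  also have "\<dots> = 0" using z xs unfolding invariant_cocycle_def by auto
  finally show ?thesis .
qed

text \<open>\<open>transfer z xs\<close> sums \<open>coboundary (restr z)\<close> along the orbit
  from \<open>xs\<close> up to the last index \<open>p - 1\<close>; starting one step later loses
  just the first term.\<close>

lemma transfer_diff:
  assumes z: "invariant_cocycle k z" and xs: "good (set xs)" "length xs = Suc (Suc k)"
  shows "transfer z xs - transfer z (map g xs) = coboundary (restr z) xs"
proof -
  let ?y = "\<lambda>m. coboundary (restr z) (map (g ^^ m) xs)"
  have ne: "set xs \<noteq> {}" using xs by auto
  have map_g: "map (g ^^ m) (map g xs) = map (g ^^ Suc m) xs" for m
    by (simp add: funpow_Suc_right del: funpow.simps)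
  have \<alpha>: "\<alpha> (set (map g xs)) = Suc (\<alpha> (set xs)) mod p"
    using \<alpha>_image[OF xs(1) ne] by simp
  have shift: "transfer z (map g xs) = (\<Sum>m<p - Suc (\<alpha> (set xs)) mod p. ?y (Suc m))"
    unfolding transfer_def \<alpha> map_g ..
  show ?thesis
  proof (cases "Suc (\<alpha> (set xs)) = p")
    case True
    \<comment> \<open>The index of \<open>map g xs\<close> wraps to 0, so its transfer is the sum
      over the whole orbit, which vanishes because \<open>z\<close> is a cocycle.\<close>
    have "(\<Sum>m<p. ?y (Suc m)) = 0"
      using sum_coboundary_restr[OF z, of "map g xs"] good_image[OF xs(1)] xs(2) unfolding map_g by simp
    then have "transfer z (map g xs) = 0" using shift True by simp
    moreover have "p - \<alpha> (set xs) = Suc 0" using True by simp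
    ultimately show ?thesis unfolding transfer_def by simp
  next
    case False
    then have "Suc (\<alpha> (set xs)) < p" using \<alpha>_less[of "set xs"] by simp
    moreover from this obtain q where "p - \<alpha> (set xs) = Suc q" "p - Suc (\<alpha> (set xs)) = q"
      by (metis Suc_diff_Suc Suc_lessD)
    ultimately show ?thesis unfolding shift unfolding transfer_def
      by (simp only: sum.lessThan_Suc_shift) simp
  qed
qed

lemma sum_transfer:
  assumes z: "invariant_cocycle k z" and xs: "good (set xs)" "length xs = Suc (Suc k)"
  shows "(\<Sum>m<p. transfer z (map (g ^^ m) xs)) =
    int p * transfer z xs + (\<Sum>m<p. int m * coboundary (restr z) (map (g ^^ m) xs))"
proof -
  let ?t = "\<lambda>m. transfer z (map (g ^^ m) xs)"
  have y: "coboundary (restr z) (map (g ^^ m) xs) = ?t m - ?t (Suc m)" for m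
    using transfer_diff[OF z, of "map (g ^^ m) xs"] good_funpow[OF xs(1), of m] xs(2)
    by (simp add: comp_def)
  show ?thesis unfolding y sum_by_parts[of ?t] using period by simp
qed

text \<open>By \<open>transfer_diff\<close> the defect of invariance of
  \<open>coboundary (transfer z)\<close> is a double coboundary.\<close>

lemma invariant_cocycle_transfer:
  assumes z: "invariant_cocycle k z"
  shows "invariant_cocycle (Suc (Suc k)) (coboundary (transfer z))"
  unfolding invariant_cocycle_def
proof (intro conjI allI impI)
  show "alternating (coboundary (transfer z))"
    using z unfolding invariant_cocycle_def by (intro alternating_coboundary alternating_transfer) auto
  fix xs assume xs: "good (set xs)"
  show "coboundary (transfer z) (map g xs) = coboundary (transfer z) xs" if l: "length xs = Suc (Suc (Suc k))"
  proof -
    have "coboundary (transfer z) xs - coboundary (transfer z) (map g xs) =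
        pairing (\<lambda>ys. transfer z ys - transfer z (map g ys)) (boundary xs)"
      by (simp add: boundary_map pairing_map_chain pairing_fun_diff)
    also have "\<dots> = pairing (coboundary (restr z)) (boundary xs)"
      using keys_boundary[of _ xs] l good_subset[OF xs] by (intro pairing_cong transfer_diff[OF z]) auto
    also have "\<dots> = 0" by (simp flip: pairing_extend add: Boundary_boundary)
    finally show ?thesis by simp
  qed
  show "coboundary (coboundary (transfer z)) xs = 0" by (simp flip: pairing_extend add: Boundary_boundary)
qed

text \<open>Summation by parts is used twice. First the orbit sum of \<open>transfer z\<close>
  becomes a weighted sum of translates of \<open>coboundary (restr z)\<close>. Then the coboundary
  is moved onto \<open>h1\<close>, whose boundary is again a difference of translates, and the
  weights dissolve into the orbit sum of \<open>restr z\<close>, which is \<open>z\<close>.\<close>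

lemma pairing_transfer_cong:
  assumes z: "invariant_cocycle k z"
    and bd1: "Boundary h1 = map_chain g h0 - h0"
    and h0: "\<And>xs. xs \<in> Poly_Mapping.keys h0 \<Longrightarrow> good (set xs) \<and> length xs = Suc k"
    and h1: "\<And>xs. xs \<in> Poly_Mapping.keys h1 \<Longrightarrow> good (set xs) \<and> length xs = Suc (Suc k)"
  shows "int p dvd (\<Sum>m<p. pairing (transfer z) (map_chain (g ^^ m) h1)) + pairing z h0"
proof -
  let ?E = "\<lambda>m. pairing (restr z) (map_chain (g ^^ m) h0)"
  have "(\<Sum>m<p. pairing (transfer z) (map_chain (g ^^ m) h1)) =
      pairing (\<lambda>xs. int p * transfer z xs + (\<Sum>m<p. int m * coboundary (restr z) (map (g ^^ m) xs))) h1"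
    unfolding pairing_map_chain pairing_fun_sum[symmetric] using h1
    by (intro pairing_cong sum_transfer[OF z]) auto
  also have "\<dots> = int p * pairing (transfer z) h1 + (\<Sum>m<p. int m * pairing (\<lambda>xs. coboundary (restr z) (map (g ^^ m) xs)) h1)"
    using pairing_fun_diff[of "\<lambda>xs. int p * transfer z xs"
        "\<lambda>xs. - (\<Sum>m<p. int m * coboundary (restr z) (map (g ^^ m) xs))" h1]
    by (simp add: pairing_fun_mult pairing_fun_sum pairing_fun_uminus)
  also have "(\<Sum>m<p. int m * pairing (\<lambda>xs. coboundary (restr z) (map (g ^^ m) xs)) h1) = (\<Sum>m<p. int m * (?E (Suc m) - ?E m))"
  proof (intro sum.cong refl)
    fix m
    have "pairing (\<lambda>xs. coboundary (restr z) (map (g ^^ m) xs)) h1 = pairing (restr z) (Boundary (map_chain (g ^^ m) h1))"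
      by (simp add: pairing_extend)
    also have "\<dots> = ?E (Suc m) - ?E m"
      by (simp add: Boundary_map_chain bd1 frag_extend_diff pairing_diff map_chain_map_chain funpow_Suc_right comp_def funpow_swap1)
    finally show "int m * pairing (\<lambda>xs. coboundary (restr z) (map (g ^^ m) xs)) h1 = int m * (?E (Suc m) - ?E m)"
      by simp
  qed
  also have "\<dots> = - (\<Sum>m<p. int m * (?E m - ?E (Suc m)))"
    by (simp only: sum_negf[symmetric] mult_minus_right[symmetric] minus_diff_eq)
  also have "\<dots> = int p * ?E 0 - (\<Sum>m<p. ?E m)"
    unfolding sum_by_parts[of ?E] using period by simp
  also have "(\<Sum>m<p. ?E m) = pairing z h0"
    unfolding pairing_map_chain pairing_fun_sum[symmetric] using h0
    by (intro pairing_cong sum_restr[OF z]) auto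
  finally show ?thesis by simp
qed

text \<open>The chains \<open>h k\<close> are linked like the generators of the periodic resolution
  of the cyclic group. The cocycles obtained by iterating \<open>transfer\<close> take values
  \<plusminus> 1 modulo \<open>p\<close> on the \<open>h k\<close> of even degree, whereas
  alternating cochains vanish on an \<open>h N\<close> all of whose lists have repetitions.\<close>

lemma exists_distinct_simplex:
  assumes h: "\<And>k xs. k \<le> N \<Longrightarrow> xs \<in> Poly_Mapping.keys (h k) \<Longrightarrow> good (set xs) \<and> length xs = Suc k"
    and h0: "pairing (\<lambda>_. 1) (h 0) = 1"
    and odd: "\<And>k. even k \<Longrightarrow> k < N \<Longrightarrow> Boundary (h (Suc k)) = map_chain g (h k) - h k"
    and even: "\<And>k. odd k \<Longrightarrow> k < N \<Longrightarrow> Boundary (h (Suc k)) = (\<Sum>m<p. map_chain (g ^^ m) (h k))"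
  shows "\<exists>xs\<in>Poly_Mapping.keys (h N). distinct xs"
proof (rule ccontr)
  assume "\<not> ?thesis"
  then have nd: "\<not> distinct xs" if "xs \<in> Poly_Mapping.keys (h N)" for xs
    using that by blast
  have ex: "\<exists>z. invariant_cocycle (2 * l) z \<and> (int p dvd pairing z (h (2 * l)) - 1 \<or> int p dvd pairing z (h (2 * l)) + 1)"
    if "2 * l \<le> N" for l
    using that
  proof (induction l)
    case 0
    \<comment> \<open>The cochain 1 in degree 0, cut off in all other degrees so that it is
      alternating.\<close>
    define z where "z = (\<lambda>xs :: 'l list. if length xs = Suc 0 then 1 else 0 :: int)"
    have z0: "z (us @ a # b # vs) = 0" for us vs a b by (simp add: z_def)
    have "alternating z" unfolding alternating_def z0 by simp
    moreover have "coboundary z xs = 0" if l: "length xs = Suc (Suc 0)" for xs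
    proof -
      obtain a b where "xs = [a, b]" using l by (cases xs; cases "tl xs") auto
      then show ?thesis by (simp add: pairing_diff cone_diff cone_of z_def)
    qed
    ultimately have "invariant_cocycle 0 z" unfolding invariant_cocycle_def by (simp add: z_def)
    moreover have "pairing z (h 0) = pairing (\<lambda>_. 1) (h 0)"
      using h[of 0] by (intro pairing_cong) (auto simp: z_def)
    ultimately show ?case using h0 by (intro exI[of _ z]) simp
  next
    case (Suc l)
    then obtain z where z: "invariant_cocycle (2 * l) z"
      and pz: "int p dvd pairing z (h (2 * l)) - 1 \<or> int p dvd pairing z (h (2 * l)) + 1" by auto
    have "pairing (coboundary (transfer z)) (h (2 * Suc l)) = pairing (transfer z) (Boundary (h (Suc (Suc (2 * l)))))"
      by (simp add: pairing_extend)
    also have "\<dots> = (\<Sum>m<p. pairing (transfer z) (map_chain (g ^^ m) (h (Suc (2 * l)))))"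
      using even[of "Suc (2 * l)"] Suc.prems by (simp add: pairing_sum)
    finally have "int p dvd pairing (coboundary (transfer z)) (h (2 * Suc l)) + pairing z (h (2 * l))"
      using pairing_transfer_cong[OF z odd[of "2 * l"] h[of "2 * l"] h[of "Suc (2 * l)"]] Suc.prems by simp
    from dvd_add_minus_one[OF this pz] show ?case
      using invariant_cocycle_transfer[OF z] by (intro exI[of _ "coboundary (transfer z)"]) simp
  qed
  have no: False if "int p dvd c - 1 \<or> int p dvd c + 1" "int p dvd c" for c
  proof -
    have "int p dvd 1"
      using that(1)
    proof
      assume "int p dvd c - 1"
      from dvd_diff[OF that(2) this] show ?thesis by simp
    next
      assume "int p dvd c + 1"
      from dvd_diff[OF this that(2)] show ?thesis by simp
    qed
    then show False using p by simp
  qed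
  show False
  proof (cases "even N")
    case True
    then obtain l where l: "N = 2 * l" by (elim evenE)
    then obtain z where z: "invariant_cocycle (2 * l) z"
      "int p dvd pairing z (h (2 * l)) - 1 \<or> int p dvd pairing z (h (2 * l)) + 1" using ex[of l] by auto
    have "pairing z (h N) = pairing (\<lambda>_. 0) (h N)"
      using z(1) nd unfolding invariant_cocycle_def by (intro pairing_cong) (blast intro: alternating_not_distinct)
    then have "pairing z (h (2 * l)) = 0" using l by (simp add: pairing_def)
    then show False using no[OF z(2)] by simp
  next
    case False
    then obtain l where l: "N = Suc (2 * l)" by (elim oddE) simp
    then obtain z where z: "invariant_cocycle (2 * l) z"
      "int p dvd pairing z (h (2 * l)) - 1 \<or> int p dvd pairing z (h (2 * l)) + 1" using ex[of l] by auto
    \<comment> \<open>The constructed cocycles have even degree. For odd \<open>N\<close> the last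
      half step uses \<open>transfer z\<close>, which is alternating too, and forces
      \<open>p\<close> to divide the value of \<open>z\<close> in degree
      \<open>N - 1\<close>.\<close>
    have "transfer z (map (g ^^ m) xs) = 0" if "xs \<in> Poly_Mapping.keys (h N)" for m xs
      using z(1) nd[OF that] alternating_not_distinct[OF alternating_transfer, of z]
      unfolding invariant_cocycle_def by (simp add: distinct_map)
    then have "pairing (transfer z) (map_chain (g ^^ m) (h N)) = pairing (\<lambda>_. 0) (h N)" for m
      unfolding pairing_map_chain by (intro pairing_cong) auto
    then have "int p dvd pairing z (h (2 * l))"
      using pairing_transfer_cong[OF z(1) odd[of "2 * l"] h[of "2 * l"] h[of "Suc (2 * l)"]] l by (simp add: pairing_def)
    then show False using no[OF z(2)] by simp
  qed
qed

end

section \<open>Barycentric subdivision\<close>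

definition barycenter :: "('i \<Rightarrow> real) list \<Rightarrow> 'i \<Rightarrow> real" where
  "barycenter xs = (\<lambda>l. (\<Sum>x\<leftarrow>xs. x l) / length xs)"

text \<open>The recursion descends through the linear extension to \<open>boundary xs\<close>, so a
  counter drives it; started at the length of the list, it reaches 0 exactly at
  \<open>[]\<close>.\<close>

primrec subdiv_upto :: "nat \<Rightarrow> ('i \<Rightarrow> real) list \<Rightarrow> ('i \<Rightarrow> real) list frag" where
  "subdiv_upto 0 xs = frag_of xs"
| "subdiv_upto (Suc k) xs = cone_chain (barycenter xs) (frag_extend (subdiv_upto k) (boundary xs))"

definition subdiv :: "('i \<Rightarrow> real) list \<Rightarrow> ('i \<Rightarrow> real) list frag" where
  "subdiv xs = subdiv_upto (length xs) xs"

abbreviation Subdiv :: "('i \<Rightarrow> real) list frag \<Rightarrow> ('i \<Rightarrow> real) list frag" where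
  "Subdiv \<equiv> frag_extend subdiv"

lemma subdiv_Nil: "subdiv [] = frag_of []"
  by (simp add: subdiv_def)

lemma subdiv_nonempty:
  assumes "xs \<noteq> []"
  shows "subdiv xs = cone_chain (barycenter xs) (Subdiv (boundary xs))"
proof -
  obtain k where k: "length xs = Suc k" using assms by (cases xs) auto
  have "frag_extend (subdiv_upto k) (boundary xs) = Subdiv (boundary xs)"
  proof (rule frag_extend_eq)
    fix ys assume "ys \<in> Poly_Mapping.keys (boundary xs)"
    then have "length ys = k" using keys_boundary[of ys xs] k by simp
    then show "subdiv_upto k ys = subdiv ys" by (simp add: subdiv_def)
  qed
  then show ?thesis using k by (simp add: subdiv_def)
qed

text \<open>The base \<open>Subdiv (boundary xs)\<close> of the cone is a cycle by induction, so it
  alone remains as the boundary. Together with \<open>Subdiv_norm_step\<close> this makes the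
  subdivided resolution satisfy the boundary relations of the original one.\<close>

lemma Boundary_subdiv: "Boundary (subdiv xs) = Subdiv (boundary xs)"
proof (induction xs rule: measure_induct_rule[of length])
  case (less xs)
  show ?case
  proof (cases "xs = []")
    case False
    have "Boundary (Subdiv (boundary xs)) = Subdiv (Boundary (boundary xs))"
      unfolding frag_extend_extend
    proof (rule frag_extend_eq)
      fix ys assume "ys \<in> Poly_Mapping.keys (boundary xs)"
      then have "length ys < length xs" using keys_boundary[of ys xs] by simp
      then show "Boundary (subdiv ys) = Subdiv (boundary ys)" by (rule less.IH)
    qed
    then show ?thesis using False by (simp add: subdiv_nonempty Boundary_cone Boundary_boundary)
  qed (simp add: subdiv_Nil)
qed

lemma Boundary_Subdiv: "Boundary (Subdiv c) = Subdiv (Boundary c)"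
  unfolding frag_extend_extend by (simp add: Boundary_subdiv)

lemma subdiv_map:
  assumes r: "\<And>xs. xs \<noteq> [] \<Longrightarrow> barycenter (map r xs) = r (barycenter xs)"
  shows "subdiv (map r xs) = map_chain r (subdiv xs)"
proof (induction xs rule: measure_induct_rule[of length])
  case (less xs)
  show ?case
  proof (cases "xs = []")
    case False
    have "Subdiv (map_chain r (boundary xs)) = map_chain r (Subdiv (boundary xs))"
      unfolding frag_extend_extend
    proof (rule frag_extend_eq)
      fix ys assume "ys \<in> Poly_Mapping.keys (boundary xs)"
      then have "length ys < length xs" using keys_boundary[of ys xs] by simp
      then show "frag_extend subdiv (frag_of (map r ys)) = map_chain r (subdiv ys)"
        unfolding frag_extend_of by (rule less.IH)
    qed
    then show ?thesis using False by (simp add: subdiv_nonempty boundary_map map_chain_cone r)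
  qed (simp add: subdiv_Nil)
qed

lemma Subdiv_map_chain:
  assumes "\<And>xs. xs \<noteq> [] \<Longrightarrow> barycenter (map r xs) = r (barycenter xs)"
  shows "Subdiv (map_chain r c) = map_chain r (Subdiv c)"
  unfolding frag_extend_extend by (simp add: subdiv_map[OF assms])

text \<open>Convexity for equal weights, the weights that occur in a subdivision. Faces of the join
  and coordinate intervals both have it, so iterated subdivision cannot leave them.\<close>

definition barycenter_closed :: "('i \<Rightarrow> real) set \<Rightarrow> bool" where
  "barycenter_closed C \<longleftrightarrow> (\<forall>xs. xs \<noteq> [] \<longrightarrow> set xs \<subseteq> C \<longrightarrow> barycenter xs \<in> C)"

lemma keys_subdiv_Cons:
  assumes "ys \<in> Poly_Mapping.keys (subdiv xs)" "xs \<noteq> []"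
  obtains zs ws where "ys = barycenter xs # zs" "zs \<in> Poly_Mapping.keys (subdiv ws)"
    "set ws \<subseteq> set xs" "Suc (length ws) = length xs"
proof -
  have "ys \<in> Poly_Mapping.keys (cone_chain (barycenter xs) (Subdiv (boundary xs)))"
    using assms by (simp add: subdiv_nonempty)
  then obtain zs where "ys = barycenter xs # zs" "zs \<in> Poly_Mapping.keys (Subdiv (boundary xs))"
    using keys_cone[of "barycenter xs" "Subdiv (boundary xs)"] by blast
  moreover from this obtain ws where "zs \<in> Poly_Mapping.keys (subdiv ws)" "ws \<in> Poly_Mapping.keys (boundary xs)"
    using keys_frag_extend[of subdiv "boundary xs"] by blast
  ultimately show ?thesis using that keys_boundary[of ws xs] by simp
qed

lemma keys_subdiv:
  assumes "ys \<in> Poly_Mapping.keys (subdiv xs)"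
  shows "length ys = length xs" and "barycenter_closed C \<Longrightarrow> set xs \<subseteq> C \<Longrightarrow> set ys \<subseteq> C"
proof -
  have "length ys = length xs \<and> (barycenter_closed C \<longrightarrow> set xs \<subseteq> C \<longrightarrow> set ys \<subseteq> C)"
    using assms
  proof (induction xs arbitrary: ys rule: measure_induct_rule[of length])
    case (less xs)
    show ?case
    proof (cases "xs = []")
      case True
      then show ?thesis using less.prems by (simp add: subdiv_Nil)
    next
      case False
      from keys_subdiv_Cons[OF less.prems False] obtain zs ws where
        *: "ys = barycenter xs # zs" "zs \<in> Poly_Mapping.keys (subdiv ws)"
        "set ws \<subseteq> set xs" "Suc (length ws) = length xs" .
      then have "length zs = length ws \<and> (barycenter_closed C \<longrightarrow> set ws \<subseteq> C \<longrightarrow> set zs \<subseteq> C)"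
        by (intro less.IH) simp_all
      moreover have "barycenter xs \<in> C" if "barycenter_closed C" "set xs \<subseteq> C"
        using that False unfolding barycenter_closed_def by blast
      ultimately show ?thesis using * by auto
    qed
  qed
  then show "length ys = length xs" and "barycenter_closed C \<Longrightarrow> set xs \<subseteq> C \<Longrightarrow> set ys \<subseteq> C" by auto
qed

lemma barycenter_closed_interval: "barycenter_closed {u. a \<le> u l \<and> u l \<le> b}"
  unfolding barycenter_closed_def
proof (intro allI impI)
  fix xs :: "('a \<Rightarrow> real) list"
  assume ne: "xs \<noteq> []" and sub: "set xs \<subseteq> {u. a \<le> u l \<and> u l \<le> b}"
  have "length xs * a \<le> (\<Sum>x\<leftarrow>xs. x l) \<and> (\<Sum>x\<leftarrow>xs. x l) \<le> length xs * b"
    using sub by (induction xs) (auto simp: algebra_simps)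
  then show "barycenter xs \<in> {u. a \<le> u l \<and> u l \<le> b}"
    using ne by (simp add: barycenter_def field_simps)
qed

text \<open>In the average of the differences \<open>y l - x l\<close> the term of \<open>x\<close>
  itself is 0, so at most \<open>length xs - 1\<close> of the \<open>length xs\<close> terms
  contribute.\<close>

lemma barycenter_near_vertex:
  assumes "x \<in> set xs" and d: "\<And>y. y \<in> set xs \<Longrightarrow> \<bar>y l - x l\<bar> \<le> \<delta>"
    and K: "length xs \<le> K"
  shows "\<bar>barycenter xs l - x l\<bar> \<le> (1 - 1 / K) * \<delta>"
proof -
  let ?n = "real (length xs)"
  have ne: "xs \<noteq> []" and n: "?n > 0" using assms(1) by (auto simp: length_pos_if_in_set)
  have \<delta>: "0 \<le> \<delta>" using d[OF assms(1)] by simp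
  have "(\<Sum>y\<leftarrow>xs. y l) - ?n * x l = (\<Sum>y\<leftarrow>xs. y l - x l)"
    by (induction xs) (auto simp: algebra_simps)
  moreover have "\<bar>\<Sum>y\<leftarrow>xs. y l - x l\<bar> \<le> (?n - 1) * \<delta>"
  proof -
    obtain us vs where xs: "xs = us @ x # vs" using split_list[OF assms(1)] by blast
    have s: "\<bar>\<Sum>y\<leftarrow>ws. y l - x l\<bar> \<le> length ws * \<delta>" if "set ws \<subseteq> set xs" for ws
      using that
    proof (induction ws)
      case (Cons w ws)
      then have "\<bar>w l - x l\<bar> \<le> \<delta>" "\<bar>\<Sum>y\<leftarrow>ws. y l - x l\<bar> \<le> length ws * \<delta>" using d by auto
      then show ?case by (simp add: algebra_simps)
    qed simp
    have "(\<Sum>y\<leftarrow>xs. y l - x l) = (\<Sum>y\<leftarrow>us @ vs. y l - x l)" by (simp add: xs)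
    moreover have "length (us @ vs) = ?n - 1" by (simp add: xs)
    ultimately show ?thesis using s[of "us @ vs"] by (auto simp: xs)
  qed
  moreover have "barycenter xs l - x l = ((\<Sum>y\<leftarrow>xs. y l) - ?n * x l) / ?n"
    using n by (simp add: barycenter_def field_simps)
  ultimately have "\<bar>barycenter xs l - x l\<bar> \<le> (?n - 1) * \<delta> / ?n"
    using n by (simp add: abs_divide divide_right_mono)
  also have "\<dots> = (1 - 1 / ?n) * \<delta>" using n by (simp add: field_simps)
  also have "\<dots> \<le> (1 - 1 / K) * \<delta>"
  proof -
    have "?n \<le> real K" using K by simp
    then show ?thesis
      using n \<delta> by (intro mult_right_mono diff_left_mono divide_left_mono mult_pos_pos) linarith+
  qed
  finally show ?thesis .
qed

text \<open>A pair of vertices either involves the new barycenter, or lies in the subdivision of a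
  face and is covered by induction. The bound \<open>K\<close> on the lengths keeps the same
  contraction factor for all faces.\<close>

lemma subdiv_mesh:
  assumes "ys \<in> Poly_Mapping.keys (subdiv xs)" "length xs \<le> K"
    and "\<And>x y. x \<in> set xs \<Longrightarrow> y \<in> set xs \<Longrightarrow> \<bar>x l - y l\<bar> \<le> \<delta>"
    and "u \<in> set ys" "v \<in> set ys"
  shows "\<bar>u l - v l\<bar> \<le> (1 - 1 / K) * \<delta>"
  using assms
proof (induction xs arbitrary: ys u v rule: measure_induct_rule[of length])
  case (less xs)
  show ?case
  proof (cases "xs = []")
    case True
    then show ?thesis using less.prems by (simp add: subdiv_Nil)
  next
    case False
    from keys_subdiv_Cons[OF less.prems(1) False] obtain zs ws where
      *: "ys = barycenter xs # zs" "zs \<in> Poly_Mapping.keys (subdiv ws)"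
      "set ws \<subseteq> set xs" "Suc (length ws) = length xs" .
    let ?d = "(1 - 1 / K) * \<delta>"
    have near: "\<bar>barycenter xs l - x l\<bar> \<le> ?d" if "x \<in> set xs" for x
      by (rule barycenter_near_vertex) (use that less.prems(2,3) in auto)
    have d0: "0 \<le> ?d" using near[OF hd_in_set[OF False]] by (rule order_trans[OF abs_ge_zero])
    have "barycenter xs l - ?d \<le> x l \<and> x l \<le> barycenter xs l + ?d" if "x \<in> set ws" for x
      using near[of x] *(3) that by (auto simp: abs_le_iff)
    \<comment> \<open>A coordinate interval around the barycenter contains the vertices of the face,
      hence also all vertices of its subdivision.\<close>
    then have "set ws \<subseteq> {u. barycenter xs l - ?d \<le> u l \<and> u l \<le> barycenter xs l + ?d}" by blast
    from keys_subdiv(2)[OF *(2) barycenter_closed_interval this]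
    have b: "\<bar>barycenter xs l - z l\<bar> \<le> ?d" if "z \<in> set zs" for z
      using that unfolding abs_le_iff by auto
    have zz: "\<bar>z l - w l\<bar> \<le> ?d" if "z \<in> set zs" "w \<in> set zs" for z w
      using less.prems(2,3) *(3,4) by (intro less.IH[OF _ *(2) _ _ that]) auto
    show ?thesis
      using less.prems(4,5) b[of u] b[of v] zz[of u v] d0 unfolding *(1)
      by (auto simp: abs_minus_commute)
  qed
qed

lemma keys_Subdiv_funpow:
  assumes "ys \<in> Poly_Mapping.keys ((Subdiv ^^ r) c)"
  shows "\<exists>xs\<in>Poly_Mapping.keys c. length ys = length xs \<and>
    (\<forall>C. barycenter_closed C \<longrightarrow> set xs \<subseteq> C \<longrightarrow> set ys \<subseteq> C) \<and>
    (\<forall>K l \<delta>. length xs \<le> K \<longrightarrow> (\<forall>x\<in>set xs. \<forall>y\<in>set xs. \<bar>x l - y l\<bar> \<le> \<delta>) \<longrightarrow>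
      (\<forall>u\<in>set ys. \<forall>v\<in>set ys. \<bar>u l - v l\<bar> \<le> (1 - 1 / real K) ^ r * \<delta>))"
  using assms
proof (induction r arbitrary: ys)
  case 0
  then show ?case by auto
next
  case (Suc r)
  obtain zs where zs: "zs \<in> Poly_Mapping.keys ((Subdiv ^^ r) c)" "ys \<in> Poly_Mapping.keys (subdiv zs)"
    using Suc.prems keys_frag_extend[of subdiv "(Subdiv ^^ r) c"] by auto
  obtain xs where xs: "xs \<in> Poly_Mapping.keys c" "length zs = length xs"
    and C: "\<forall>C. barycenter_closed C \<longrightarrow> set xs \<subseteq> C \<longrightarrow> set zs \<subseteq> C"
    and mesh: "\<forall>K l \<delta>. length xs \<le> K \<longrightarrow> (\<forall>x\<in>set xs. \<forall>y\<in>set xs. \<bar>x l - y l\<bar> \<le> \<delta>) \<longrightarrow>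
      (\<forall>u\<in>set zs. \<forall>v\<in>set zs. \<bar>u l - v l\<bar> \<le> (1 - 1 / real K) ^ r * \<delta>)"
    using Suc.IH[OF zs(1)] by (elim bexE conjE)
  have len: "length ys = length xs" using keys_subdiv(1)[OF zs(2)] xs(2) by simp
  moreover have "set ys \<subseteq> C" if "barycenter_closed C" "set xs \<subseteq> C" for C
    using keys_subdiv(2)[OF zs(2) that(1)] C that by simp
  moreover have "\<bar>u l - v l\<bar> \<le> (1 - 1 / real K) ^ Suc r * \<delta>"
    if "length xs \<le> K" "\<forall>x\<in>set xs. \<forall>y\<in>set xs. \<bar>x l - y l\<bar> \<le> \<delta>" "u \<in> set ys" "v \<in> set ys" for K l \<delta> u v
  proof -
    have "\<forall>u\<in>set zs. \<forall>v\<in>set zs. \<bar>u l - v l\<bar> \<le> (1 - 1 / real K) ^ r * \<delta>"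
      using mesh that(1,2) by blast
    then have "\<bar>u l - v l\<bar> \<le> (1 - 1 / real K) * ((1 - 1 / real K) ^ r * \<delta>)"
      using that xs(2) by (intro subdiv_mesh[OF zs(2)]) auto
    then show ?thesis by (simp add: mult.assoc)
  qed
  ultimately show ?case using xs(1) by (intro bexI[of _ xs] conjI allI impI ballI) blast+
qed

section \<open>The join of copies of the cyclic group\<close>

text \<open>One permutation serves two kinds of pairs: piece and colour for the points, measure and
  colour for the labels. Pairs whose second entry is not below \<open>p\<close> are fixed, so that
  the \<open>p\<close>-th power is the identity on the whole type.\<close>

definition color_shift :: "nat \<Rightarrow> nat \<times> nat \<Rightarrow> nat \<times> nat" where
  "color_shift p = (\<lambda>(j, a). (j, if a < p then Suc a mod p else a))"

text \<open>For \<open>p > 0\<close> the power \<open>p - 1\<close> is the inverse shift, so the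
  value of \<open>x\<close> at \<open>l\<close> reappears in \<open>rot p x\<close> at
  \<open>color_shift p l\<close>.\<close>

definition rot :: "nat \<Rightarrow> (nat \<times> nat \<Rightarrow> real) \<Rightarrow> nat \<times> nat \<Rightarrow> real" where
  "rot p x = x \<circ> (color_shift p ^^ (p - 1))"

text \<open>The simplex of the join in which piece \<open>j\<close> has colour \<open>c j\<close>
  and weight \<open>x (j, c j)\<close>. Two faces meet in the points whose weights vanish wherever
  the colourings differ, which is the gluing of the join.\<close>

definition face :: "(nat \<Rightarrow> nat) \<Rightarrow> nat \<Rightarrow> (nat \<times> nat \<Rightarrow> real) set" where
  "face c k = {x. (\<forall>l. 0 \<le> x l) \<and> (\<forall>j a. x (j, a) \<noteq> 0 \<longrightarrow> j \<le> k \<and> a = c j) \<and> (\<Sum>j\<le>k. x (j, c j)) = 1}"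

lemma faceD:
  assumes "x \<in> face c k"
  shows "0 \<le> x l" "x (j, a) \<noteq> 0 \<Longrightarrow> j \<le> k \<and> a = c j" "(\<Sum>j\<le>k. x (j, c j)) = 1"
proof -
  have *: "\<forall>l. 0 \<le> x l" "\<forall>j a. x (j, a) \<noteq> 0 \<longrightarrow> j \<le> k \<and> a = c j" "(\<Sum>j\<le>k. x (j, c j)) = 1"
    using assms unfolding face_def by blast+
  show "0 \<le> x l" using *(1) by (rule spec)
  show "x (j, a) \<noteq> 0 \<Longrightarrow> j \<le> k \<and> a = c j" using *(2) by blast
  show "(\<Sum>j\<le>k. x (j, c j)) = 1" by (rule *(3))
qed

lemma faceI:
  assumes "\<And>l. 0 \<le> x l" "\<And>j a. x (j, a) \<noteq> 0 \<Longrightarrow> j \<le> k \<and> a = c j" "(\<Sum>j\<le>k. x (j, c j)) = 1"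
  shows "x \<in> face c k"
  using assms unfolding face_def by auto

definition color_vertex :: "nat \<Rightarrow> nat \<Rightarrow> nat \<times> nat \<Rightarrow> real" where
  "color_vertex j a = (\<lambda>l. if l = (j, a) then 1 else 0)"

lemma color_shift_funpow: "a < p \<Longrightarrow> (color_shift p ^^ m) (j, a) = (j, (a + m) mod p)"
  by (induction m) (auto simp: color_shift_def mod_simps)

lemma color_shift_funpow_ge: "\<not> a < p \<Longrightarrow> (color_shift p ^^ m) (j, a) = (j, a)"
  by (induction m) (auto simp: color_shift_def)

lemma color_shift_period: "color_shift p ^^ p = id"
proof
  fix l :: "nat \<times> nat"
  show "(color_shift p ^^ p) l = id l"
    using color_shift_funpow[of "snd l" p p "fst l"] color_shift_funpow_ge[of "snd l" p p "fst l"]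
    by (cases "snd l < p") simp_all
qed

lemma color_shift_inverse: "0 < p \<Longrightarrow> (color_shift p ^^ (p - 1)) (color_shift p l) = l"
  using fun_cong[OF color_shift_period, of p l] by (cases p) (simp_all add: funpow_swap1)

lemma color_shift_inverse': "0 < p \<Longrightarrow> color_shift p ((color_shift p ^^ (p - 1)) l) = l"
  using fun_cong[OF color_shift_period, of p l] by (cases p) simp_all

lemma rot_color_shift: "0 < p \<Longrightarrow> rot p x (color_shift p l) = x l"
  unfolding rot_def comp_def by (simp only: color_shift_inverse)

lemma rot_funpow: "rot p ^^ m = (\<lambda>x. x \<circ> (color_shift p ^^ ((p - 1) * m)))"
proof (induction m)
  case (Suc m)
  have "(rot p ^^ Suc m) x = x \<circ> (color_shift p ^^ ((p - 1) * Suc m))" for x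
    by (simp only: funpow.simps comp_apply[of "rot p"] Suc rot_def mult_Suc_right comp_assoc
        funpow_add[symmetric] add.commute)
  then show ?case by (rule ext)
qed (simp add: fun_eq_iff)

lemma rot_period: "rot p ^^ p = id"
proof -
  have "color_shift p ^^ ((p - 1) * p) = (color_shift p ^^ p) ^^ (p - 1)"
    by (simp add: funpow_mult mult.commute)
  then show ?thesis by (simp add: rot_funpow color_shift_period fun_eq_iff)
qed

lemma rot_face:
  assumes p: "0 < p" and c: "\<And>j. c j < p" and x: "x \<in> face c k"
  shows "rot p x \<in> face (\<lambda>j. Suc (c j) mod p) k"
proof -
  have r: "rot p x (j, Suc (c j) mod p) = x (j, c j)" for j
    using rot_color_shift[OF p, of x "(j, c j)"] c[of j] by (simp add: color_shift_def)
  have "j \<le> k \<and> a = Suc (c j) mod p" if "rot p x (j, a) \<noteq> 0" for j a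
  proof -
    obtain b where b: "(color_shift p ^^ (p - 1)) (j, a) = (j, b)"
      using color_shift_funpow[of a p "p - 1" j] color_shift_funpow_ge[of a p "p - 1" j] by (cases "a < p") auto
    then have "x (j, b) \<noteq> 0" using that by (simp add: rot_def)
    then have *: "j \<le> k" "b = c j" using faceD(2)[OF x] by auto
    moreover have "(j, a) = color_shift p (j, b)" using color_shift_inverse'[OF p, of "(j, a)"] b by simp
    ultimately show ?thesis using c[of j] by (simp add: color_shift_def)
  qed
  moreover have "0 \<le> rot p x l" for l unfolding rot_def comp_def by (rule faceD(1)[OF x])
  ultimately show ?thesis using faceD(3)[OF x] by (intro faceI) (simp_all add: r)
qed

lemma barycenter_rot: "barycenter (map (rot p) xs) = rot p (barycenter xs)"
  by (simp add: barycenter_def rot_def fun_eq_iff comp_def)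

lemma sum_list_sum_swap: "(\<Sum>x\<leftarrow>xs. \<Sum>j\<in>A. f x j) = (\<Sum>j\<in>A. \<Sum>x\<leftarrow>xs. f x j :: real)"
  by (induction xs) (auto simp: sum.distrib)

lemma barycenter_closed_face: "barycenter_closed (face c k)"
  unfolding barycenter_closed_def
proof (intro allI impI)
  fix xs :: "(nat \<times> nat \<Rightarrow> real) list"
  assume ne: "xs \<noteq> []" and sub: "set xs \<subseteq> face c k"
  have "0 \<le> barycenter xs l" for l
    unfolding barycenter_def using sub
    by (intro divide_nonneg_nonneg sum_list_nonneg) (auto dest!: subsetD intro: faceD(1) simp del: split_paired_All)
  moreover have "j \<le> k \<and> a = c j" if "barycenter xs (j, a) \<noteq> 0" for j a
  proof (rule ccontr)
    assume "\<not> ?thesis"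
    then have "x (j, a) = 0" if "x \<in> set xs" for x
      using faceD(2)[of x c k j a] sub that by blast
    then have "map (\<lambda>x. x (j, a)) xs = map (\<lambda>x. 0) xs" by simp
    then have "barycenter xs (j, a) = 0" unfolding barycenter_def by (simp only: sum_list_0 div_0)
    then show False using that by simp
  qed
  moreover have "(\<Sum>j\<le>k. barycenter xs (j, c j)) = 1"
  proof -
    have "(\<Sum>x\<leftarrow>xs. \<Sum>j\<le>k. x (j, c j)) = (\<Sum>x\<leftarrow>xs. 1)"
      using sub by (intro arg_cong[where f = sum_list] map_cong faceD(3)) auto
    also have "\<dots> = length xs" by (simp add: sum_list_triv)
    finally show ?thesis using ne
      by (simp add: barycenter_def sum_list_sum_swap flip: sum_divide_distrib)
  qed
  ultimately show "barycenter xs \<in> face c k" by (rule faceI)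
qed

section \<open>Chains of the periodic resolution inside the join\<close>

definition norm_step :: "nat \<Rightarrow> nat \<Rightarrow> ('a \<Rightarrow> 'a) \<Rightarrow> 'a list frag \<Rightarrow> 'a list frag" where
  "norm_step p k g c = (if even k then map_chain g c - c else (\<Sum>m<p. map_chain (g ^^ m) c))"

text \<open>Each step cones off a cycle from a vertex of a new copy of the cyclic group, so the
  boundary of the new chain is that cycle, and the chain of degree \<open>k\<close> fits into the
  join of \<open>k + 1\<close> copies.\<close>

primrec resolution :: "nat \<Rightarrow> nat \<Rightarrow> (nat \<times> nat \<Rightarrow> real) list frag" where
  "resolution p 0 = frag_of [color_vertex 0 0]"
| "resolution p (Suc k) = cone_chain (color_vertex (Suc k) 0) (norm_step p k (rot p) (resolution p k))"

lemma Boundary_norm_step: "Boundary (norm_step p k g c) = norm_step p k g (Boundary c)"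
  by (simp add: norm_step_def frag_extend_diff frag_extend_sum comp_def Boundary_map_chain)

lemma map_chain_sum: "map_chain g (\<Sum>m<q. f m) = (\<Sum>m<q. map_chain g (f m))" for q :: nat
  by (simp add: frag_extend_sum comp_def)

text \<open>Both products of \<open>g - 1\<close> with the norm telescope to
  \<open>g ^^ p - id\<close>.\<close>

lemma norm_step_norm_step:
  assumes "g ^^ p = id"
  shows "norm_step p (Suc k) g (norm_step p k g c) = 0"
proof -
  have *: "(\<Sum>m<p. map_chain (g ^^ Suc m) c) - (\<Sum>m<p. map_chain (g ^^ m) c) = 0"
    unfolding sum_subtractf[symmetric] using sum_lessThan_telescope[of "\<lambda>m. map_chain (g ^^ m) c" p] assms
    by simp
  have 1: "map_chain g (map_chain (g ^^ m) c) = map_chain (g ^^ Suc m) c" for m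
    by (simp add: map_chain_map_chain comp_def)
  have 2: "map_chain (g ^^ m) (map_chain g c) = map_chain (g ^^ Suc m) c" for m
    by (simp only: map_chain_map_chain funpow_Suc_right)
  show ?thesis
    using * unfolding norm_step_def
    by (auto simp: map_chain_sum 1 2 frag_extend_diff sum_subtractf simp del: funpow.simps)
qed

lemma Boundary_resolution:
  assumes "0 < p"
  shows "Boundary (resolution p (Suc k)) = norm_step p k (rot p) (resolution p k)"
proof -
  have "Boundary (norm_step p k (rot p) (resolution p k)) = 0"
  proof (induction k)
    case 0
    show ?case by (simp add: norm_step_def frag_extend_diff)
  next
    case (Suc k)
    have "Boundary (resolution p (Suc k)) = norm_step p k (rot p) (resolution p k)"
      using Suc by (simp add: Boundary_cone)
    then show ?case by (simp only: Boundary_norm_step norm_step_norm_step[OF rot_period])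
  qed
  then show ?thesis by (simp add: Boundary_cone)
qed

lemma color_vertex_face:
  assumes "c j = a" "j \<le> k"
  shows "color_vertex j a \<in> face c k"
proof -
  have "(\<Sum>i\<le>k. color_vertex j a (i, c i)) = (\<Sum>i\<le>k. if i = j then 1 else 0)"
    using assms by (intro sum.cong) (auto simp: color_vertex_def)
  then show ?thesis using assms by (intro faceI) (auto simp: color_vertex_def split: if_splits)
qed

lemma face_Suc:
  assumes "x \<in> face c k"
  shows "x \<in> face (c(Suc k := 0)) (Suc k)"
proof -
  have 0: "x (Suc k, a) = 0" for a using faceD(2)[OF assms, of "Suc k" a] by auto
  moreover have "(\<Sum>j\<le>k. x (j, (c(Suc k := 0)) j)) = (\<Sum>j\<le>k. x (j, c j))"
    by (intro sum.cong) auto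
  moreover have "j \<le> Suc k \<and> a = (c(Suc k := 0)) j" if "x (j, a) \<noteq> 0" for j a
    using faceD(2)[OF assms that] by auto
  ultimately show ?thesis using faceD(1,3)[OF assms] by (intro faceI) simp_all
qed

lemma keys_norm_step:
  assumes "xs \<in> Poly_Mapping.keys (norm_step p k g c)"
  shows "\<exists>ys\<in>Poly_Mapping.keys c. \<exists>m. xs = map (g ^^ m) ys"
proof (cases "even k")
  case True
  then have "xs \<in> Poly_Mapping.keys (map_chain (g ^^ 1) c) \<union> Poly_Mapping.keys (map_chain (g ^^ 0) c)"
    using assms keys_diff[of "map_chain g c" c] by (auto simp: norm_step_def)
  then show ?thesis using keys_map_chain[of "g ^^ 1" c] keys_map_chain[of "g ^^ 0" c] by blast
next
  case False
  then have "xs \<in> Poly_Mapping.keys (\<Sum>m<p. map_chain (g ^^ m) c)"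
    using assms by (simp add: norm_step_def)
  then obtain m where "xs \<in> Poly_Mapping.keys (map_chain (g ^^ m) c)"
    using keys_sum[of "\<lambda>m. map_chain (g ^^ m) c" "{..<p}"] by blast
  then show ?thesis using keys_map_chain[of "g ^^ m" c] by blast
qed

lemma rot_funpow_face:
  assumes p: "0 < p" and c: "\<And>j. c j < p"
  shows "\<exists>c'. (\<forall>j. c' j < p) \<and> (rot p ^^ m) ` face c k \<subseteq> face c' k"
proof (induction m)
  case 0
  show ?case using c by auto
next
  case (Suc m)
  then obtain c' where c': "\<forall>j. c' j < p" "(rot p ^^ m) ` face c k \<subseteq> face c' k" by blast
  then have "rot p ((rot p ^^ m) x) \<in> face (\<lambda>j. Suc (c' j) mod p) k" if "x \<in> face c k" for x
    using that by (intro rot_face[OF p]) auto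
  then show ?case using p by (intro exI[of _ "\<lambda>j. Suc (c' j) mod p"]) auto
qed

text \<open>A common face for all vertices of a list matters for subdivision: a barycenter of points
  from different faces could leave the join.\<close>

lemma keys_resolution:
  assumes p: "0 < p" and "xs \<in> Poly_Mapping.keys (resolution p k)"
  shows "length xs = Suc k \<and> (\<exists>c. (\<forall>j. c j < p) \<and> set xs \<subseteq> face c k)"
  using assms(2)
proof (induction k arbitrary: xs)
  case 0
  then have "xs = [color_vertex 0 0]" by simp
  moreover have "color_vertex 0 0 \<in> face (\<lambda>_. 0) 0" by (intro color_vertex_face) auto
  ultimately show ?case using p by auto
next
  case (Suc k)
  then obtain zs where zs: "zs \<in> Poly_Mapping.keys (norm_step p k (rot p) (resolution p k))"
    "xs = color_vertex (Suc k) 0 # zs"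
    using keys_cone[of "color_vertex (Suc k) 0" "norm_step p k (rot p) (resolution p k)"] by auto
  then obtain ys m where ys: "ys \<in> Poly_Mapping.keys (resolution p k)" "zs = map (rot p ^^ m) ys"
    using keys_norm_step by blast
  obtain c where l: "length ys = Suc k" and c: "\<forall>j. c j < p" "set ys \<subseteq> face c k"
    using Suc.IH[OF ys(1)] by (elim conjE exE)
  obtain c' where c': "\<forall>j. c' j < p" "(rot p ^^ m) ` face c k \<subseteq> face c' k"
    using rot_funpow_face[OF p, of c m k] c(1) by blast
  have "set zs \<subseteq> face c' k" using c' c(2) ys(2) by auto
  then have "set zs \<subseteq> face (c'(Suc k := 0)) (Suc k)" using face_Suc by blast
  moreover have "color_vertex (Suc k) 0 \<in> face (c'(Suc k := 0)) (Suc k)" by (intro color_vertex_face) auto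
  ultimately have "set xs \<subseteq> face (c'(Suc k := 0)) (Suc k)" using zs(2) by simp
  moreover have "\<forall>j. (c'(Suc k := 0)) j < p" using c'(1) p by simp
  moreover have "length xs = Suc (Suc k)" using zs(2) l ys(2) by simp
  ultimately show ?case by blast
qed

section \<open>Equivariant labels\<close>

text \<open>These are the simplices of the join of \<open>n\<close> copies of the boundary of a
  simplex with \<open>p\<close> vertices.\<close>

definition incomplete :: "nat \<Rightarrow> nat \<Rightarrow> (nat \<times> nat) set \<Rightarrow> bool" where
  "incomplete n p S \<longleftrightarrow> S \<subseteq> {..<n} \<times> {..<p} \<and> (\<forall>i<n. \<exists>a<p. (i, a) \<notin> S)"

lemma inj_color_shift: "0 < p \<Longrightarrow> inj (color_shift p)"
  by (rule inj_on_inverseI[where g = "color_shift p ^^ (p - 1)"]) (rule color_shift_inverse)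

lemma inj_on_Suc_mod:
  assumes "0 < p"
  shows "inj_on (\<lambda>a. Suc a mod p) {..<p}"
proof (rule inj_onI)
  fix a b assume "a \<in> {..<p}" "b \<in> {..<p}" "Suc a mod p = Suc b mod p"
  then show "a = b" using injD[OF inj_color_shift[OF assms], of "(0, a)" "(0, b)"] by (simp add: color_shift_def)
qed

lemma fst_color_shift: "fst (color_shift p l) = fst l"
  by (simp add: color_shift_def split_beta)

lemma color_shift_mem: "0 < p \<Longrightarrow> color_shift p l \<in> {..<n} \<times> {..<p} \<longleftrightarrow> l \<in> {..<n} \<times> {..<p}"
  by (cases l) (auto simp: color_shift_def)

lemma mem_color_shift_image: "0 < p \<Longrightarrow> color_shift p l \<in> color_shift p ` S \<longleftrightarrow> l \<in> S"
  by (rule inj_image_mem_iff[OF inj_color_shift])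

lemma incomplete_color_shift:
  assumes p: "0 < p" and S: "incomplete n p S"
  shows "incomplete n p (color_shift p ` S)"
proof -
  have "\<exists>a<p. (i, a) \<notin> color_shift p ` S" if i: "i < n" for i
  proof -
    obtain a where a: "a < p" "(i, a) \<notin> S" using S i unfolding incomplete_def by blast
    then have "color_shift p (i, a) \<notin> color_shift p ` S" using mem_color_shift_image[OF p] by blast
    moreover have "color_shift p (i, a) = (i, Suc a mod p)" using a(1) by (simp add: color_shift_def)
    ultimately show ?thesis using p by (intro exI[of _ "Suc a mod p"]) simp
  qed
  moreover have "color_shift p ` S \<subseteq> {..<n} \<times> {..<p}"
    using S color_shift_mem[OF p] unfolding incomplete_def by blast
  ultimately show ?thesis unfolding incomplete_def by blast
qed

lemma incomplete_subset: "incomplete n p S \<Longrightarrow> T \<subseteq> S \<Longrightarrow> incomplete n p T"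
  unfolding incomplete_def by blast

text \<open>Each of the \<open>n\<close> measures misses a colour. Compared with the
  \<open>N + 1\<close> entries of a distinct list in degree \<open>N\<close>, this is where the
  number \<open>n * (p - 1)\<close> of cuts is decisive.\<close>

lemma card_incomplete:
  assumes "incomplete n p S"
  shows "card S \<le> n * (p - 1)"
proof -
  obtain f where f: "\<forall>i<n. f i < p \<and> (i, f i) \<notin> S"
    using assms unfolding incomplete_def by metis
  have "S \<subseteq> (SIGMA i:{..<n}. {..<p} - {f i})"
    using assms f unfolding incomplete_def by fastforce
  then have "card S \<le> card (SIGMA i:{..<n}. {..<p} - {f i})" by (intro card_mono) auto
  also have "\<dots> = (\<Sum>i<n. card ({..<p} - {f i}))" by (subst card_SigmaI) auto
  also have "\<dots> = (\<Sum>i<n. p - 1)" using f by (intro sum.cong) auto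
  finally show ?thesis by simp
qed

text \<open>The shift preserves first components, so the least one in \<open>S\<close> is the same
  along the orbit. For a nonempty incomplete \<open>S\<close> its colours form a nonempty proper
  subset of the \<open>p\<close> colours, of which a mean can be taken.\<close>

definition first_column :: "(nat \<times> nat) set \<Rightarrow> nat set" where
  "first_column S = {a. ((LEAST i. i \<in> fst ` S), a) \<in> S}"

lemma first_column_props:
  assumes S: "incomplete n p S" "S \<noteq> {}"
  shows "first_column S \<noteq> {}" "first_column S \<subset> {..<p}"
proof -
  obtain i where i: "i = (LEAST i. i \<in> fst ` S)" "i \<in> fst ` S"
    using LeastI_ex[of "\<lambda>i. i \<in> fst ` S"] S(2) by auto
  then show "first_column S \<noteq> {}" unfolding first_column_def by auto
  have "i < n" using i(2) S unfolding incomplete_def by auto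
  then obtain a where "a < p" "(i, a) \<notin> S" using S unfolding incomplete_def by blast
  then show "first_column S \<subset> {..<p}"
    using S unfolding first_column_def incomplete_def by (auto simp flip: i(1))
qed

lemma first_column_color_shift:
  assumes "incomplete n p S" "0 < p"
  shows "first_column (color_shift p ` S) = (\<lambda>a. Suc a mod p) ` first_column S"
proof -
  have fst: "fst ` color_shift p ` S = fst ` S" by (simp add: image_image fst_color_shift)
  let ?i = "LEAST i. i \<in> fst ` S"
  have "(?i, b) \<in> color_shift p ` S \<longleftrightarrow> (\<exists>a. b = Suc a mod p \<and> (?i, a) \<in> S)" for b
  proof
    assume "(?i, b) \<in> color_shift p ` S"
    then obtain j a where "(j, a) \<in> S" "(?i, b) = color_shift p (j, a)" by auto
    moreover from this have "a < p" using assms unfolding incomplete_def by auto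
    ultimately show "\<exists>a. b = Suc a mod p \<and> (?i, a) \<in> S" by (auto simp: color_shift_def)
  next
    assume "\<exists>a. b = Suc a mod p \<and> (?i, a) \<in> S"
    then obtain a where a: "b = Suc a mod p" "(?i, a) \<in> S" by blast
    then have "a < p" using assms unfolding incomplete_def by auto
    then have "(?i, b) = color_shift p (?i, a)" using a(1) by (simp add: color_shift_def)
    then show "(?i, b) \<in> color_shift p ` S" using a(2) by (rule image_eqI)
  qed
  then show ?thesis unfolding first_column_def fst by blast
qed

text \<open>Shifting adds 1 to every colour modulo \<open>p\<close>, hence 1 to the mean of the
  first column. The mean exists because the size of a nonempty proper subset of \<open>p\<close>
  colours is invertible modulo the prime \<open>p\<close>.\<close>

lemma ex_equivariant_index:
  assumes p: "prime p"
  shows "\<exists>\<alpha>. (\<forall>S. \<alpha> S < p) \<and>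
    (\<forall>S. incomplete n p S \<longrightarrow> S \<noteq> {} \<longrightarrow> \<alpha> (color_shift p ` S) = Suc (\<alpha> S) mod p)"
proof -
  have p0: "0 < p" using p by (simp add: prime_gt_0_nat)
  let ?A = first_column
  \<comment> \<open>the mean of the first column, computed in the field with \<open>p\<close> elements\<close>
  define Q where "Q = (\<lambda>S m. m < p \<and> [m * card (?A S) = \<Sum>(?A S)] (mod p))"
  define \<alpha> where "\<alpha> = (\<lambda>S. if incomplete n p S \<and> S \<noteq> {} then SOME m. Q S m else 0)"
  have cop: "coprime (card (?A S)) p" if "incomplete n p S" "S \<noteq> {}" for S
  proof -
    have "card (?A S) < p"
      using psubset_card_mono[OF _ first_column_props(2)[OF that]] by simp
    moreover have "0 < card (?A S)"
      using first_column_props[OF that] finite_subset[of "?A S" "{..<p}"] by (simp add: card_gt_0_iff psubset_imp_subset)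
    ultimately show ?thesis using p by (metis coprime_commute nat_dvd_not_less prime_imp_coprime_nat)
  qed
  have ex: "Q S (\<alpha> S)" if S: "incomplete n p S" "S \<noteq> {}" for S
  proof -
    obtain u where u: "[card (?A S) * u = 1] (mod p)"
      using cong_solve_coprime_nat[OF cop[OF S]] unfolding One_nat_def[symmetric] by (elim exE)
    define m where "m = (\<Sum>(?A S) * u) mod p"
    have "[m * card (?A S) = \<Sum>(?A S) * u * card (?A S)] (mod p)"
      unfolding m_def by (intro cong_scalar_right) (simp add: unique_euclidean_semiring_class.cong_def)
    also have "\<Sum>(?A S) * u * card (?A S) = \<Sum>(?A S) * (card (?A S) * u)" by (simp add: mult_ac)
    also have "[\<dots> = \<Sum>(?A S) * 1] (mod p)" by (intro cong_scalar_left u)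
    finally have "Q S m" using p0 unfolding Q_def by (simp add: m_def)
    then have "Q S (SOME m. Q S m)" by (rule someI)
    then show ?thesis using S by (simp add: \<alpha>_def)
  qed
  have "\<alpha> (color_shift p ` S) = Suc (\<alpha> S) mod p" if S: "incomplete n p S" "S \<noteq> {}" for S
  proof -
    have S': "incomplete n p (color_shift p ` S)" "color_shift p ` S \<noteq> {}" using incomplete_color_shift[OF p0] S by auto
    have fin: "?A S \<subseteq> {..<p}" using first_column_props(2)[OF S] by blast
    have inj: "inj_on (\<lambda>a. Suc a mod p) (?A S)" by (rule inj_on_subset[OF inj_on_Suc_mod[OF p0] fin])
    have card: "card (?A (color_shift p ` S)) = card (?A S)"
      unfolding first_column_color_shift[OF S(1) p0] by (rule card_image[OF inj])
    have "\<Sum>(?A (color_shift p ` S)) = (\<Sum>a\<in>?A S. Suc a mod p)"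
      unfolding first_column_color_shift[OF S(1) p0] by (simp add: sum.reindex[OF inj])
    moreover have "[(\<Sum>a\<in>?A S. Suc a mod p) = (\<Sum>a\<in>?A S. Suc a)] (mod p)"
      by (intro cong_sum) (simp add: unique_euclidean_semiring_class.cong_def)
    ultimately have "[\<Sum>(?A (color_shift p ` S)) = \<Sum>(?A S) + card (?A S)] (mod p)"
      by (simp only: sum_Suc)
    moreover have "[\<alpha> (color_shift p ` S) * card (?A S) = \<Sum>(?A (color_shift p ` S))] (mod p)"
      using ex[OF S'] card unfolding Q_def by simp
    moreover have "[\<alpha> S * card (?A S) + card (?A S) = \<Sum>(?A S) + card (?A S)] (mod p)"
      using ex[OF S] unfolding Q_def by (intro cong_add) auto
    ultimately have "[\<alpha> (color_shift p ` S) * card (?A S) = \<alpha> S * card (?A S) + card (?A S)] (mod p)"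
      by (meson cong_sym cong_trans)
    then have "[\<alpha> (color_shift p ` S) * card (?A S) = Suc (\<alpha> S) * card (?A S)] (mod p)"
      by (simp only: mult_Suc add.commute)
    then have "[\<alpha> (color_shift p ` S) = Suc (\<alpha> S)] (mod p)"
      using cop[OF S] by (simp only: cong_mult_rcancel_nat)
    then show ?thesis using ex[OF S'] unfolding Q_def unique_euclidean_semiring_class.cong_def by simp
  qed
  moreover have "\<alpha> S < p" for S
    using ex[of S] p0 unfolding Q_def by (cases "incomplete n p S \<and> S \<noteq> {}") (auto simp: \<alpha>_def)
  ultimately show ?thesis by blast
qed

text \<open>An element is chosen in one set of each orbit, the one of index 0, and carried
  back.\<close>

lemma ex_equivariant_choice:
  assumes p: "prime p"
  shows "\<exists>\<phi>. \<forall>S. incomplete n p S \<longrightarrow> S \<noteq> {} \<longrightarrow> \<phi> S \<in> S \<and> \<phi> (color_shift p ` S) = color_shift p (\<phi> S)"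
proof -
  have p0: "0 < p" using p by (simp add: prime_gt_0_nat)
  obtain \<alpha> where \<alpha>: "\<And>S. \<alpha> S < p"
    "\<And>S. incomplete n p S \<Longrightarrow> S \<noteq> {} \<Longrightarrow> \<alpha> (color_shift p ` S) = Suc (\<alpha> S) mod p"
    using ex_equivariant_index[OF p, of n] by blast
  let ?s = "color_shift p"
  \<comment> \<open>The translate of \<open>S\<close> with index 0; it is the same set for
    \<open>S\<close> and for its shift.\<close>
  define B where "B = (\<lambda>S. (?s ^^ (p - \<alpha> S)) ` S)"
  define \<phi> where "\<phi> = (\<lambda>S. (?s ^^ \<alpha> S) (SOME b. b \<in> B S))"
  have period: "(?s ^^ p) l = l" for l using color_shift_period[of p] by simp
  have "\<phi> S \<in> S" if ne: "S \<noteq> {}" for S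
  proof -
    have "B S \<noteq> {}" using ne unfolding B_def by simp
    then have "(SOME b. b \<in> B S) \<in> B S" by (simp add: some_in_eq)
    then obtain x where x: "x \<in> S" "(SOME b. b \<in> B S) = (?s ^^ (p - \<alpha> S)) x" unfolding B_def by blast
    have "\<phi> S = (?s ^^ (\<alpha> S + (p - \<alpha> S))) x" unfolding \<phi>_def x(2) by (simp add: funpow_add)
    then show ?thesis using x(1) \<alpha>(1)[of S] period by simp
  qed
  moreover have "\<phi> (?s ` S) = ?s (\<phi> S)" if S: "incomplete n p S" "S \<noteq> {}" for S
  proof (cases "Suc (\<alpha> S) = p")
    case True
    have 0: "\<alpha> (?s ` S) = 0" using \<alpha>(2)[OF S] True by simp
    have "p - \<alpha> S = 1" using True by simp
    then have "B S = ?s ` S" unfolding B_def by simp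
    moreover have "B (?s ` S) = ?s ` S" unfolding B_def 0 by (simp add: period)
    ultimately have "?s (\<phi> S) = (?s ^^ Suc (\<alpha> S)) (\<phi> (?s ` S))" unfolding \<phi>_def 0 by simp
    then show ?thesis using True period by simp
  next
    case False
    then have lt: "Suc (\<alpha> S) < p" using \<alpha>(1)[of S] by simp
    then have s: "\<alpha> (?s ` S) = Suc (\<alpha> S)" using \<alpha>(2)[OF S] by simp
    have "B (?s ` S) = (?s ^^ Suc (p - Suc (\<alpha> S))) ` S"
      unfolding B_def s by (simp add: image_image funpow_swap1)
    also have "Suc (p - Suc (\<alpha> S)) = p - \<alpha> S" using lt by simp
    finally show ?thesis unfolding \<phi>_def s B_def by simp
  qed
  ultimately show ?thesis by blast
qed

section \<open>Compactness of the join and the size of subdivided simplices\<close>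

lemma face_mono: "k \<le> K \<Longrightarrow> face c k \<subseteq> face c K"
proof
  fix x assume k: "k \<le> K" and x: "x \<in> face c k"
  have "(\<Sum>j\<le>K. x (j, c j)) = (\<Sum>j\<le>k. x (j, c j))"
    using k faceD(2)[OF x] by (intro sum.mono_neutral_right) auto
  moreover have "j \<le> K \<and> a = c j" if "x (j, a) \<noteq> 0" for j a
    using faceD(2)[OF x that] k by auto
  ultimately show "x \<in> face c K" using faceD(1,3)[OF x] by (intro faceI) simp_all
qed

lemma face_le_1:
  assumes "x \<in> face c k"
  shows "x l \<le> 1"
proof (cases "x l = 0")
  case False
  obtain j a where l: "l = (j, a)" by (cases l)
  then have "j \<le> k" "a = c j" using faceD(2)[OF assms] False by auto
  moreover have "x (j, c j) \<le> (\<Sum>j\<le>k. x (j, c j))"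
    using faceD(1)[OF assms] \<open>j \<le> k\<close> by (intro member_le_sum) auto
  ultimately have "x l \<le> (\<Sum>j\<le>k. x (j, c j))" unfolding l by simp
  then show ?thesis using faceD(3)[OF assms] by simp
qed simp

lemma compact_cube_fun: "compact {x :: 'i \<Rightarrow> real. \<forall>l. x l \<in> {0..1}}"
proof -
  have "compactin (product_topology (\<lambda>_ :: 'i. euclidean) UNIV) (PiE UNIV (\<lambda>_. {0..1 :: real}))"
    by (subst compactin_PiE) auto
  moreover have "PiE UNIV (\<lambda>_. {0..1 :: real}) = {x :: 'i \<Rightarrow> real. \<forall>l. x l \<in> {0..1}}"
    by (auto simp: PiE_def)
  ultimately show ?thesis by (simp add: euclidean_product_topology)
qed

lemma compact_face: "compact (face c k)"
proof -
  have eq: "face c k = {x. \<forall>l. x l \<in> {0..1}} \<inter>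
      ((\<Inter>l\<in>{(j, a). \<not> (j \<le> k \<and> a = c j)}. {x. x l = 0}) \<inter> {x. (\<Sum>j\<le>k. x (j, c j)) = 1})"
    (is "_ = ?K \<inter> (?A \<inter> ?B)")
  proof (intro equalityI subsetI)
    fix x assume x: "x \<in> face c k"
    show "x \<in> ?K \<inter> (?A \<inter> ?B)"
      using faceD[OF x] face_le_1[OF x] by auto
  next
    fix x assume "x \<in> ?K \<inter> (?A \<inter> ?B)"
    then show "x \<in> face c k" by (intro faceI) auto
  qed
  have "closed ?A"
    by (intro closed_INT ballI closed_Collect_eq continuous_intros continuous_on_product_coordinates)
  moreover have "closed ?B"
    by (intro closed_Collect_eq continuous_intros continuous_on_product_coordinates)
  ultimately show ?thesis unfolding eq
    by (intro compact_Int_closed compact_cube_fun closed_Int)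
qed

definition color_join :: "nat \<Rightarrow> nat \<Rightarrow> (nat \<times> nat \<Rightarrow> real) set" where
  "color_join p k = (\<Union>c\<in>{c. \<forall>j. c j < p}. face c k)"

text \<open>A colouring \<open>c\<close> is a function on all naturals, but \<open>face c k\<close>
  depends only on its values up to \<open>k\<close>, so finitely many faces remain.\<close>

lemma compact_color_join:
  assumes "0 < p"
  shows "compact (color_join p k)"
proof -
  let ?C = "PiE {..k} (\<lambda>_. {..<p})"
  have "color_join p k = (\<Union>c\<in>?C. face c k)"
  proof (intro equalityI subsetI)
    fix x assume "x \<in> color_join p k"
    then obtain c where c: "\<forall>j. c j < p" "x \<in> face c k" unfolding color_join_def by blast
    have "x \<in> face (restrict c {..k}) k"
      using faceD[OF c(2)] by (intro faceI) auto
    moreover have "restrict c {..k} \<in> ?C" using c(1) by auto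
    ultimately show "x \<in> (\<Union>c\<in>?C. face c k)" by blast
  next
    fix x assume "x \<in> (\<Union>c\<in>?C. face c k)"
    then obtain c where c: "c \<in> ?C" "x \<in> face c k" by blast
    define c' where "c' = (\<lambda>j. if j \<le> k then c j else 0)"
    have "x \<in> face c' k" using faceD[OF c(2)] by (intro faceI) (auto simp: c'_def)
    moreover have "\<forall>j. c' j < p" using c(1) assms by (auto simp: c'_def)
    ultimately show "x \<in> color_join p k" unfolding color_join_def by blast
  qed
  moreover have "finite ?C" by (intro finite_PiE) auto
  ultimately show ?thesis using compact_face by (simp add: compact_UN)
qed

text \<open>Relates the coordinatewise mesh to the metric of the function space, where a distance is
  at most twice the maximum over finitely many coordinates plus a tail \<open>(1 / 2) ^ N\<close>;
  with \<open>d / 8\<close> this is less than \<open>d / 4 + d / 2\<close>.\<close>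

lemma dist_fun_small:
  assumes "0 < d"
  shows "\<exists>\<epsilon>>0. \<forall>x y :: 'i :: countable \<Rightarrow> real. (\<forall>l. \<bar>x l - y l\<bar> \<le> \<epsilon>) \<longrightarrow> dist x y < d"
proof -
  obtain N where N: "(1 / 2 :: real) ^ N < d / 2"
    using real_arch_pow_inv[of "d / 2" "1 / 2"] assms by auto
  show ?thesis
  proof (intro exI[of _ "d / 8"] conjI allI impI)
    fix x y :: "'i \<Rightarrow> real" assume *: "\<forall>l. \<bar>x l - y l\<bar> \<le> d / 8"
    have "Max {dist (x (from_nat n)) (y (from_nat n)) |n. n \<le> N} \<le> d / 8"
      using * by (subst Max_le_iff) (auto simp: dist_real_def)
    then show "dist x y < d"
      using dist_fun_le_dist_first_terms[of x y N] N assms by linarith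
  qed (use assms in simp)
qed

lemma uniformly_continuous_family:
  fixes D :: "'l \<Rightarrow> 'a :: metric_space \<Rightarrow> real"
  assumes "compact X" "finite L" "\<And>l. l \<in> L \<Longrightarrow> continuous_on X (D l)" "0 < e"
  shows "\<exists>d>0. \<forall>l\<in>L. \<forall>x\<in>X. \<forall>y\<in>X. dist x y < d \<longrightarrow> \<bar>D l x - D l y\<bar> < e"
  using assms(2,3)
proof (induction L)
  case empty
  show ?case by (intro exI[of _ 1]) simp
next
  case (insert l L)
  then obtain d where d: "d > 0" "\<forall>l\<in>L. \<forall>x\<in>X. \<forall>y\<in>X. dist x y < d \<longrightarrow> \<bar>D l x - D l y\<bar> < e" by auto
  have "uniformly_continuous_on X (D l)"
    using insert.prems assms(1) by (intro compact_uniformly_continuous) auto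
  then obtain d' where d': "d' > 0" "\<forall>x\<in>X. \<forall>y\<in>X. dist y x < d' \<longrightarrow> dist (D l y) (D l x) < e"
    unfolding uniformly_continuous_on_def using assms(4) by metis
  show ?case
    using d d' by (intro exI[of _ "min d d'"]) (auto simp: dist_real_def)
qed

lemma Subdiv_norm_step: "Subdiv (norm_step p k (rot p) c) = norm_step p k (rot p) (Subdiv c)"
proof -
  have "barycenter (map (rot p ^^ m) xs) = (rot p ^^ m) (barycenter xs)" for m xs
  proof (induction m)
    case (Suc m)
    then show ?case using barycenter_rot[of p "map (rot p ^^ m) xs"] by (simp add: comp_def)
  qed simp
  then have "Subdiv (map_chain (rot p ^^ m) c) = map_chain (rot p ^^ m) (Subdiv c)" for m c
    by (intro Subdiv_map_chain)
  from this this[of 1] show ?thesis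
    unfolding norm_step_def by (simp add: frag_extend_diff frag_extend_sum comp_def)
qed

lemma Subdiv_funpow_norm_step: "(Subdiv ^^ r) (norm_step p k (rot p) c) = norm_step p k (rot p) ((Subdiv ^^ r) c)"
  by (induction r) (simp_all add: Subdiv_norm_step)

lemma Boundary_Subdiv_funpow: "Boundary ((Subdiv ^^ r) c) = (Subdiv ^^ r) (Boundary c)"
  by (induction r) (simp_all add: Boundary_Subdiv)

lemma Subdiv_funpow_singleton: "(Subdiv ^^ r) (frag_of [x]) = frag_of [x]"
proof -
  have "barycenter [x] = x" by (simp add: barycenter_def)
  then have "subdiv [x] = frag_of [x]" by (simp add: subdiv_nonempty subdiv_Nil cone_chain_def)
  then show ?thesis by (induction r) simp_all
qed

lemma map_chain_norm_step:
  assumes "\<And>m xs x. xs \<in> Poly_Mapping.keys c \<Longrightarrow> x \<in> set xs \<Longrightarrow> lab ((g ^^ m) x) = (h ^^ m) (lab x)"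
  shows "map_chain lab (norm_step p k g c) = norm_step p k h (map_chain lab c)"
proof -
  have "map_chain lab (map_chain (g ^^ m) c) = map_chain (h ^^ m) (map_chain lab c)" for m
    unfolding map_chain_map_chain
  proof (rule frag_extend_eq)
    fix xs assume "xs \<in> Poly_Mapping.keys c"
    then have "map (lab \<circ> g ^^ m) xs = map (h ^^ m \<circ> lab) xs" using assms by simp
    then show "frag_of (map (lab \<circ> g ^^ m) xs) = frag_of (map (h ^^ m \<circ> lab) xs)" by (simp only:)
  qed
  from this this[of 1] show ?thesis
    unfolding norm_step_def by (simp add: frag_extend_diff map_chain_sum)
qed

lemma rot_color_join:
  assumes p: "0 < p" and x: "x \<in> color_join p k"
  shows "rot p x \<in> color_join p k"
proof -
  obtain c where c: "\<forall>j. c j < p" "x \<in> face c k" using x unfolding color_join_def by blast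
  then have "rot p x \<in> face (\<lambda>j. Suc (c j) mod p) k" by (intro rot_face[OF p]) auto
  moreover have "(\<lambda>j. Suc (c j) mod p) \<in> {c. \<forall>j. c j < p}" using p by simp
  ultimately show ?thesis unfolding color_join_def by blast
qed

text \<open>If no small simplex carries all labels of one column, then the labelling maps the subdivided
  join into a complex of dimension \<open>n (p - 1) - 1\<close>, which the resolution cannot survive.\<close>

theorem equivariant_labelling:
  fixes lab :: "(nat \<times> nat \<Rightarrow> real) \<Rightarrow> nat \<times> nat"
  assumes p: "prime p" and n: "N = n * (p - 1)" and \<epsilon>: "0 < \<epsilon>"
    and equiv: "\<And>x. x \<in> color_join p N \<Longrightarrow> lab (rot p x) = color_shift p (lab x)"
    and small: "\<And>A. finite A \<Longrightarrow> A \<subseteq> color_join p N \<Longrightarrow> (\<And>x y l. x \<in> A \<Longrightarrow> y \<in> A \<Longrightarrow> \<bar>x l - y l\<bar> \<le> \<epsilon>) \<Longrightarrow>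
      incomplete n p (lab ` A)"
  shows False
proof -
  have p2: "2 \<le> p" and p0: "0 < p" using p by (simp_all add: prime_ge_2_nat prime_gt_0_nat)
  obtain \<alpha> where \<alpha>: "\<And>S. \<alpha> S < p"
    "\<And>S. incomplete n p S \<Longrightarrow> S \<noteq> {} \<Longrightarrow> \<alpha> (color_shift p ` S) = Suc (\<alpha> S) mod p"
    using ex_equivariant_index[OF p, of n] by blast
  interpret free_cyclic_labels p "color_shift p" "incomplete n p" \<alpha>
    using p2 \<alpha> incomplete_color_shift[OF p0] incomplete_subset color_shift_period by unfold_locales auto
  \<comment> \<open>Coordinates lie in [0, 1] and lists have at most \<open>N + 1\<close> entries,
    so \<open>r\<close> subdivisions bring every coordinate distance down to this power.\<close>
  obtain r where r: "(1 - 1 / real (Suc N)) ^ r < \<epsilon>"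
    using real_arch_pow_inv[OF \<epsilon>, of "1 - 1 / real (Suc N)"] by (auto simp: field_simps)
  have keys_sub: "length ys = Suc k \<and> set ys \<subseteq> color_join p N \<and>
      (\<forall>l. \<forall>u\<in>set ys. \<forall>v\<in>set ys. \<bar>u l - v l\<bar> \<le> \<epsilon>)"
    if k: "k \<le> N" and ys: "ys \<in> Poly_Mapping.keys ((Subdiv ^^ r) (resolution p k))" for k ys
  proof -
    obtain xs where xs: "xs \<in> Poly_Mapping.keys (resolution p k)" "length ys = length xs"
      and C: "\<forall>C. barycenter_closed C \<longrightarrow> set xs \<subseteq> C \<longrightarrow> set ys \<subseteq> C"
      and mesh: "\<forall>K l \<delta>. length xs \<le> K \<longrightarrow> (\<forall>x\<in>set xs. \<forall>y\<in>set xs. \<bar>x l - y l\<bar> \<le> \<delta>) \<longrightarrow>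
        (\<forall>u\<in>set ys. \<forall>v\<in>set ys. \<bar>u l - v l\<bar> \<le> (1 - 1 / real K) ^ r * \<delta>)"
      using keys_Subdiv_funpow[OF ys] by (elim bexE conjE)
    obtain c where len: "length xs = Suc k" and c: "\<forall>j. c j < p" "set xs \<subseteq> face c k"
      using keys_resolution[OF p0 xs(1)] by (elim conjE exE)
    have "set ys \<subseteq> face c k" using C barycenter_closed_face c(2) by blast
    then have "set ys \<subseteq> color_join p N"
      using face_mono[OF k, of c] c(1) unfolding color_join_def by blast
    moreover have "\<bar>u l - v l\<bar> \<le> \<epsilon>" if "u \<in> set ys" "v \<in> set ys" for u v l
    proof -
      have "\<bar>x l - y l\<bar> \<le> 1" if "x \<in> face c k" "y \<in> face c k" for x y
        using faceD(1)[OF that(1), of l] faceD(1)[OF that(2), of l] face_le_1[OF that(1), of l]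
          face_le_1[OF that(2), of l] by linarith
      then have "\<forall>x\<in>set xs. \<forall>y\<in>set xs. \<bar>x l - y l\<bar> \<le> 1" using c(2) by blast
      moreover have "length xs \<le> Suc N" using len k by simp
      ultimately have "\<bar>u l - v l\<bar> \<le> (1 - 1 / real (Suc N)) ^ r * 1"
        using mesh[rule_format, of "Suc N" l 1 u v] that by blast
      then show ?thesis using r by linarith
    qed
    ultimately show ?thesis using len xs(2) by simp
  qed
  define h where "h = (\<lambda>k. map_chain lab ((Subdiv ^^ r) (resolution p k)))"
  have keys_h: "incomplete n p (set zs) \<and> length zs = Suc k" if k: "k \<le> N" and zs: "zs \<in> Poly_Mapping.keys (h k)" for k zs
  proof -
    obtain ys where ys: "ys \<in> Poly_Mapping.keys ((Subdiv ^^ r) (resolution p k))" "zs = map lab ys"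
      using zs keys_map_chain unfolding h_def by blast
    then show ?thesis using keys_sub[OF k ys(1)] small[of "set ys"] by auto
  qed
  have orbit: "(rot p ^^ m) x \<in> color_join p N \<and> lab ((rot p ^^ m) x) = (color_shift p ^^ m) (lab x)"
    if "x \<in> color_join p N" for x m
    using that by (induction m) (auto simp: rot_color_join[OF p0] equiv)
  have Boundary_h: "Boundary (h (Suc k)) = norm_step p k (color_shift p) (h k)" if k: "k < N" for k
  proof -
    have "Boundary (h (Suc k)) = map_chain lab (norm_step p k (rot p) ((Subdiv ^^ r) (resolution p k)))"
      unfolding h_def Boundary_map_chain Boundary_Subdiv_funpow Boundary_resolution[OF p0] Subdiv_funpow_norm_step ..
    also have "\<dots> = norm_step p k (color_shift p) (h k)"
      unfolding h_def
    proof (rule map_chain_norm_step)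
      fix m xs x assume "xs \<in> Poly_Mapping.keys ((Subdiv ^^ r) (resolution p k))" "x \<in> set xs"
      then have "x \<in> color_join p N" using keys_sub[of k xs] k by auto
      then show "lab ((rot p ^^ m) x) = (color_shift p ^^ m) (lab x)" using orbit by blast
    qed
    finally show ?thesis .
  qed
  have "pairing (\<lambda>_. 1) (h 0) = 1" by (simp add: h_def Subdiv_funpow_singleton)
  moreover have "Boundary (h (Suc k)) = map_chain (color_shift p) (h k) - h k" if "even k" "k < N" for k
    using Boundary_h[OF that(2)] that(1) by (simp add: norm_step_def)
  moreover have "Boundary (h (Suc k)) = (\<Sum>m<p. map_chain (color_shift p ^^ m) (h k))" if "odd k" "k < N" for k
    using Boundary_h[OF that(2)] that(1) by (simp add: norm_step_def)
  ultimately obtain zs where zs: "zs \<in> Poly_Mapping.keys (h N)" "distinct zs"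
    using exists_distinct_simplex[of N h] keys_h by blast
  then have "card (set zs) = Suc N" using keys_h[of N zs] by (simp add: distinct_card)
  then show False using card_incomplete[of n p "set zs"] keys_h[OF _ zs(1)] n by simp
qed

text \<open>If a small simplex carried a full column of labels, continuity would make all excesses
  of that measure positive at one point, although they sum to zero. So
  \<open>equivariant_labelling\<close> applies to the labels of maximal excess.\<close>

theorem equivariant_balanced_point:
  fixes F :: "nat \<times> nat \<Rightarrow> (nat \<times> nat \<Rightarrow> real) \<Rightarrow> real"
  assumes p: "prime p" and N: "N = n * (p - 1)"
    and cont: "\<And>l. continuous_on (color_join p N) (F l)"
    and equiv: "\<And>x l. x \<in> color_join p N \<Longrightarrow> l \<in> {..<n} \<times> {..<p} \<Longrightarrow> F (color_shift p l) (rot p x) = F l x"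
  shows "\<exists>x\<in>color_join p N. \<forall>i<n. \<forall>a<p. \<forall>b<p. F (i, a) x = F (i, b) x"
proof (rule ccontr)
  assume no: "\<not> ?thesis"
  have p0: "0 < p" using p by (simp add: prime_gt_0_nat)
  define L where "L = {..<n} \<times> {..<p}"
  define X where "X = color_join p N"
  define D where "D = (\<lambda>l x. F l x - (\<Sum>b<p. F (fst l, b) x) / p)"
  have D_sum: "(\<Sum>a<p. D (i, a) x) = 0" for i x
    using p0 by (simp add: D_def sum_subtractf)
  have D_equiv: "D (color_shift p l) (rot p x) = D l x" if x: "x \<in> X" and l: "l \<in> L" for x l
  proof -
    have "fst l < n" using l by (auto simp: L_def)
    then have "F (fst l, Suc b mod p) (rot p x) = F (fst l, b) x" if "b < p" for b
      using equiv[of x "(fst l, b)"] x that by (simp add: X_def color_shift_def)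
    then have "(\<Sum>b<p. F (fst l, b) x) = (\<Sum>b<p. F (fst l, Suc b mod p) (rot p x))" by simp
    also have "\<dots> = (\<Sum>b<p. F (fst l, b) (rot p x))"
    proof (rule sum.reindex_bij_betw)
      show "bij_betw (\<lambda>b. Suc b mod p) {..<p} {..<p}"
        using p0 by (intro bij_betw_imageI endo_inj_surj inj_on_Suc_mod) auto
    qed
    finally show ?thesis using equiv[of x l] x l by (simp add: D_def X_def L_def fst_color_shift)
  qed
  have D_pos: "\<exists>l\<in>L. D l x > 0" if x: "x \<in> X" for x
  proof (rule ccontr)
    assume none: "\<not> ?thesis"
    have "0 \<le> - D (i, a) x" if "i < n" "a < p" for i a
    proof -
      have "(i, a) \<in> L" using that by (simp add: L_def)
      then have "\<not> D (i, a) x > 0" using none by blast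
      then show ?thesis by simp
    qed
    note nonneg = this
    have D0: "D (i, a) x = 0" if "i < n" "a < p" for i a
    proof -
      have "(\<Sum>a<p. - D (i, a) x) = 0" by (simp only: sum_negf D_sum minus_zero)
      then have "- D (i, a) x = 0"
        using sum_nonneg_0[of "{..<p}" "\<lambda>a. - D (i, a) x" a] nonneg[OF that(1)] that(2) by simp
      then show ?thesis by simp
    qed
    have "F (i, a) x = F (i, b) x" if "i < n" "a < p" "b < p" for i a b
      using D0[OF that(1,2)] D0[OF that(1,3)] by (simp add: D_def)
    then show False using no x unfolding X_def by blast
  qed
  have fin: "finite L" by (simp add: L_def)
  have X: "compact X" unfolding X_def by (rule compact_color_join[OF p0])
  have D_cont: "continuous_on X (D l)" for l
    unfolding D_def X_def using p0 by (intro continuous_intros cont) auto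
  define M where "M = (\<lambda>x. Max ((\<lambda>l. D l x) ` L))"
  define S where "S = (\<lambda>x. {l \<in> L. D l x = M x})"
  have M_ge: "D l x \<le> M x" if "l \<in> L" for l x using that fin by (simp add: M_def)
  have M_pos: "0 < M x" if "x \<in> X" for x using D_pos[OF that] M_ge[of _ x] by force
  have S_ne: "S x \<noteq> {}" if "x \<in> X" for x
  proof -
    have "M x \<in> (\<lambda>l. D l x) ` L" unfolding M_def using fin D_pos[OF that] by (intro Max_in) auto
    then show ?thesis unfolding S_def image_iff by (metis (mono_tags, lifting) empty_iff mem_Collect_eq)
  qed
  have S_incomplete: "incomplete n p (S x)" if x: "x \<in> X" for x
  proof -
    have "\<exists>a<p. (i, a) \<notin> S x" for i
    proof (rule ccontr)
      assume "\<not> ?thesis"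
      then have "(\<Sum>a<p. D (i, a) x) = (\<Sum>a<p. M x)" by (intro sum.cong) (auto simp: S_def)
      then show False using D_sum M_pos[OF x] p0 by simp
    qed
    then show ?thesis by (auto simp: incomplete_def S_def L_def)
  qed
  have M_rot: "M (rot p x) = M x" if x: "x \<in> X" for x
  proof -
    have "color_shift p ` L = L"
    proof (rule endo_inj_surj[OF fin])
      show "color_shift p ` L \<subseteq> L" using color_shift_mem[OF p0] unfolding L_def by blast
      show "inj_on (color_shift p) L" by (rule inj_on_subset[OF inj_color_shift[OF p0] subset_UNIV])
    qed
    then have "(\<lambda>l. D l (rot p x)) ` L = (\<lambda>l. D l (rot p x)) ` (color_shift p ` L)" by (simp only:)
    also have "\<dots> = (\<lambda>l. D (color_shift p l) (rot p x)) ` L" by (simp only: image_image)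
    also have "\<dots> = (\<lambda>l. D l x) ` L" using D_equiv[OF x] by (intro image_cong) auto
    finally show ?thesis by (simp add: M_def)
  qed
  have S_rot: "S (rot p x) = color_shift p ` S x" if x: "x \<in> X" for x
  proof (intro equalityI subsetI)
    fix l assume l: "l \<in> S (rot p x)"
    define l' where "l' = (color_shift p ^^ (p - 1)) l"
    have l': "l = color_shift p l'" using color_shift_inverse'[OF p0] by (simp add: l'_def)
    have "color_shift p l' \<in> L" using l unfolding S_def l' by blast
    then have "l' \<in> L" unfolding L_def by (rule iffD1[OF color_shift_mem[OF p0]])
    moreover have "D (color_shift p l') (rot p x) = M x" using l unfolding S_def l' M_rot[OF x] by blast
    ultimately have "l' \<in> S x" using D_equiv[OF x, of l'] unfolding S_def by simp
    then show "l \<in> color_shift p ` S x" unfolding l' by (rule imageI)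
  next
    fix l assume "l \<in> color_shift p ` S x"
    then obtain l' where l': "l = color_shift p l'" "l' \<in> L" "D l' x = M x" unfolding S_def by blast
    have "l \<in> L" using l'(2) unfolding l'(1) L_def by (rule iffD2[OF color_shift_mem[OF p0]])
    then show "l \<in> S (rot p x)"
      using D_equiv[OF x l'(2)] M_rot[OF x] l'(1,3) unfolding S_def by simp
  qed
  \<comment> \<open>Ties in the maximum are broken equivariantly.\<close>
  obtain \<phi> where \<phi>: "\<And>S. incomplete n p S \<Longrightarrow> S \<noteq> {} \<Longrightarrow> \<phi> S \<in> S"
    "\<And>S. incomplete n p S \<Longrightarrow> S \<noteq> {} \<Longrightarrow> \<phi> (color_shift p ` S) = color_shift p (\<phi> S)"
    using ex_equivariant_choice[OF p, of n] by blast
  define lab where "lab = (\<lambda>x. \<phi> (S x))"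
  have lab_S: "lab x \<in> S x" if "x \<in> X" for x
    unfolding lab_def using \<phi>(1) S_incomplete S_ne that by blast
  obtain \<delta> where \<delta>: "0 < \<delta>" "\<And>x. x \<in> X \<Longrightarrow> \<delta> \<le> M x"
  proof -
    \<comment> \<open>A continuous substitute for the maximum: \<open>P\<close> is a sum of
      continuous functions, is positive on \<open>X\<close>, and bounds \<open>M\<close> from below
      up to the factor \<open>card L\<close>.\<close>
    define P where "P = (\<lambda>x. \<Sum>l\<in>L. max 0 (D l x))"
    have P_le: "P x \<le> card L * M x" if x: "x \<in> X" for x
      unfolding P_def using M_ge[of _ x] M_pos[OF x] by (intro sum_bounded_above) auto
    have P_pos: "0 < P x" if x: "x \<in> X" for x
    proof -
      obtain l where "l \<in> L" "D l x > 0" using D_pos[OF x] by blast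
      then show ?thesis unfolding P_def by (intro sum_pos2[OF fin, of l]) auto
    qed
    show ?thesis
    proof (cases "X = {}")
      case True
      then show ?thesis using that[of 1] by simp
    next
      case False
      have "continuous_on X P" unfolding P_def by (intro continuous_intros D_cont)
      then obtain x0 where x0: "x0 \<in> X" "\<forall>y\<in>X. P x0 \<le> P y"
        using continuous_attains_inf[OF X False, of P] by blast
      have "L \<noteq> {}" using D_pos[OF x0(1)] by blast
      then have cL: "0 < card L" using fin by (simp add: card_gt_0_iff)
      have "P x0 / card L \<le> M x" if "x \<in> X" for x
        using order_trans[OF bspec[OF x0(2) that] P_le[OF that]] cL by (simp add: field_simps)
      then show ?thesis using that[of "P x0 / card L"] P_pos[OF x0(1)] cL by simp
    qed
  qed
  obtain d where d: "0 < d" "\<forall>l\<in>L. \<forall>x\<in>X. \<forall>y\<in>X. dist x y < d \<longrightarrow> \<bar>D l x - D l y\<bar> < \<delta>"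
    using uniformly_continuous_family[of X L D, OF X fin D_cont \<delta>(1)] by blast
  obtain \<epsilon> where \<epsilon>: "0 < \<epsilon>"
    "\<forall>x y :: nat \<times> nat \<Rightarrow> real. (\<forall>l. \<bar>x l - y l\<bar> \<le> \<epsilon>) \<longrightarrow> dist x y < d"
    using dist_fun_small[OF d(1), where 'i = "nat \<times> nat"] by blast
  show False
  proof (rule equivariant_labelling[OF p N \<epsilon>(1), of lab])
    show "lab (rot p x) = color_shift p (lab x)" if "x \<in> color_join p N" for x
      using that S_rot \<phi>(2) S_incomplete S_ne unfolding lab_def X_def by simp
    fix A assume A: "finite A" "A \<subseteq> color_join p N" "\<And>x y l. x \<in> A \<Longrightarrow> y \<in> A \<Longrightarrow> \<bar>x l - y l\<bar> \<le> \<epsilon>"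
    have AX: "x \<in> X" if "x \<in> A" for x using A(2) that by (auto simp: X_def)
    have "\<exists>a<p. (i, a) \<notin> lab ` A" if "i < n" for i
    proof (rule ccontr)
      assume "\<not> ?thesis"
      then have all: "\<exists>y\<in>A. (i, a) = lab y" if "a < p" for a using that by blast
      obtain x where x: "x \<in> A" using all[OF p0] by blast
      have "D (i, a) x > 0" if "a < p" for a
      proof -
        obtain y where y: "y \<in> A" "(i, a) = lab y" using all[OF \<open>a < p\<close>] by blast
        then have ia: "(i, a) \<in> L" "D (i, a) y = M y" using lab_S[OF AX[OF y(1)]]
          unfolding S_def by auto
        have "\<bar>D (i, a) y - D (i, a) x\<bar> < \<delta>"
          by (intro d(2)[rule_format] \<epsilon>(2)[rule_format] ia(1) AX A(3) y(1) x)
        then show ?thesis using ia(2) \<delta>(2)[OF AX[OF y(1)]] by linarith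
      qed
      then have "0 < (\<Sum>a<p. D (i, a) x)" using p0 by (intro sum_pos) auto
      then show False using D_sum by simp
    qed
    moreover have "lab x \<in> {..<n} \<times> {..<p}" if "x \<in> A" for x
      using lab_S[OF AX[OF that]] unfolding S_def L_def by blast
    ultimately show "incomplete n p (lab ` A)" unfolding incomplete_def by blast
  qed
qed

section \<open>Cutting the cube\<close>

definition upper :: "real ^ 'd \<Rightarrow> (real ^ 'd) set" where
  "upper v = {y. \<forall>i. v $ i \<le> y $ i}"

definition upper_mass :: "(real ^ 'd \<Rightarrow> real) \<Rightarrow> real ^ 'd \<Rightarrow> real" where
  "upper_mass f v = (LINT y|lebesgue. f y * indicator (upper v) y)"

lemma sets_upper [measurable]: "upper v \<in> sets lebesgue"
proof -
  have "closed (upper v)"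
    unfolding upper_def by (intro closed_Collect_all closed_Collect_le continuous_intros)
  then show ?thesis by (simp add: borel_closed)
qed

lemma AE_coordinate_neq: "AE y in lebesgue. (y :: real ^ 'd) $ i \<noteq> c"
proof -
  have "negligible {y :: real ^ 'd. y $ i = c}"
    using negligible_standard_hyperplane[of "axis i 1 :: real ^ 'd" c]
    by (simp add: cart_eq_inner_axis axis_in_Basis_iff)
  then have "{y :: real ^ 'd. y $ i = c} \<in> null_sets lebesgue"
    by (simp add: negligible_iff_null_sets)
  then show ?thesis by (auto dest: AE_not_in)
qed

text \<open>Dominated convergence: when no coordinate of \<open>y\<close> equals that of
  \<open>v\<close>, membership of \<open>y\<close> in \<open>upper (V k)\<close> is eventually
  constant. The exceptional points lie on finitely many hyperplanes.\<close>

lemma continuous_upper_mass: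
  fixes f :: "real ^ 'd \<Rightarrow> real"
  assumes f: "integrable lebesgue f"
  shows "continuous_on UNIV (upper_mass f)"
  unfolding continuous_on_sequentially
proof (intro allI ballI impI, elim conjE)
  fix V :: "nat \<Rightarrow> real ^ 'd" and v assume V: "V \<longlonglongrightarrow> v"
  have [measurable]: "f \<in> borel_measurable lebesgue" using f by (rule borel_measurable_integrable)
  have "AE y in lebesgue. \<forall>i\<in>UNIV. (y :: real ^ 'd) $ i \<noteq> v $ i"
    by (intro AE_finite_allI AE_coordinate_neq) simp
  then have conv: "AE y in lebesgue. (\<lambda>k. f y * indicator (upper (V k)) y) \<longlonglongrightarrow> f y * indicator (upper v) y"
  proof eventually_elim
    case (elim y)
    have "\<forall>\<^sub>F k in sequentially. (V k $ i \<le> y $ i) = (v $ i \<le> y $ i)" for i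
    proof -
      have lim: "(\<lambda>k. V k $ i) \<longlonglongrightarrow> v $ i" by (rule tendsto_vec_nth[OF V])
      consider "v $ i < y $ i" | "y $ i < v $ i" using elim[rule_format, of i] by (meson UNIV_I linorder_neqE)
      then show ?thesis
      proof cases
        case 1
        then show ?thesis using order_tendstoD(2)[OF lim 1] by (auto elim!: eventually_mono)
      next
        case 2
        then show ?thesis using order_tendstoD(1)[OF lim 2] by (auto elim!: eventually_mono)
      qed
    qed
    then have "\<forall>\<^sub>F k in sequentially. \<forall>i. (V k $ i \<le> y $ i) = (v $ i \<le> y $ i)"
      by (intro eventually_all_finite) auto
    then have "\<forall>\<^sub>F k in sequentially. f y * indicator (upper (V k)) y = f y * indicator (upper v) y"
      by eventually_elim (simp add: upper_def indicator_def)
    then show ?case by (rule tendsto_eventually)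
  qed
  have "(\<lambda>k. upper_mass f (V k)) \<longlonglongrightarrow> upper_mass f v"
    unfolding upper_mass_def
  proof (rule integral_dominated_convergence[where w = "\<lambda>y. \<bar>f y\<bar>"])
    show "integrable lebesgue (\<lambda>y. \<bar>f y\<bar>)" using f by (rule integrable_abs)
    show "AE y in lebesgue. norm (f y * indicator (upper (V k)) y) \<le> \<bar>f y\<bar>" for k
      by (intro AE_I2) (simp add: indicator_def)
  qed (use conv in auto)
  then show "(upper_mass f \<circ> V) \<longlonglongrightarrow> upper_mass f v" by (simp add: comp_def)
qed

text \<open>Constancy on cells is expressed by sides of cuts instead of connected components, so
  that it survives adding cut positions. The strict inequality settles the side also for points on
  the cuts.\<close>

definition determined :: "('d \<Rightarrow> real set) \<Rightarrow> (real ^ 'd \<Rightarrow> nat) \<Rightarrow> bool" where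
  "determined Z col \<longleftrightarrow> (\<forall>y\<in>unit_cube. \<forall>y'\<in>unit_cube.
     (\<forall>i. \<forall>z\<in>Z i. y $ i < z \<longleftrightarrow> y' $ i < z) \<longrightarrow> col y = col y')"

text \<open>The number of cuts in each direction is only bounded above, since cuts may coincide or
  fall outside the cube. The target is a fraction of the integral rather than \<open>1 / k\<close>,
  because the notion is applied to densities restricted to a colour class.\<close>

definition split_by ::
  "('d \<Rightarrow> real set) \<Rightarrow> (real ^ 'd \<Rightarrow> nat) \<Rightarrow> (nat \<Rightarrow> real ^ 'd \<Rightarrow> real) \<Rightarrow> nat \<Rightarrow> nat \<Rightarrow> 'd list \<Rightarrow> bool" where
  "split_by Z col f n k ds \<longleftrightarrow>
     (\<forall>i. finite (Z i) \<and> Z i \<subseteq> {0..1} \<and> card (Z i) \<le> count_list ds i) \<and>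
     determined Z col \<and> (\<forall>y. col y < k) \<and>
     (\<forall>i<n. \<forall>j<k. (LINT y|lebesgue. f i y * indicator {y \<in> unit_cube. col y = j} y) = (LINT y|lebesgue. f i y) / k)"

definition densities :: "nat \<Rightarrow> (nat \<Rightarrow> real ^ 'd \<Rightarrow> real) \<Rightarrow> bool" where
  "densities n f \<longleftrightarrow> (\<forall>i<n. integrable lebesgue (f i) \<and> (\<forall>y. y \<notin> unit_cube \<longrightarrow> f i y = 0))"

lemma sets_unit_cube [measurable]: "unit_cube \<in> sets lebesgue"
  by (simp add: unit_cube_def)

text \<open>There are finitely many sign patterns \<open>s y\<close> relative to the cuts, each cuts
  out a measurable set, and the colour is a function of the pattern.\<close>

lemma sets_determined:
  fixes Z :: "'d :: finite \<Rightarrow> real set"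
  assumes Z: "\<And>i. finite (Z i)" and col: "determined Z col"
  shows "{y \<in> unit_cube. col y = j} \<in> sets lebesgue"
proof -
  define s where "s = (\<lambda>y :: real ^ 'd. SIGMA i:UNIV. {z \<in> Z i. y $ i < z})"
  let ?A = "{y \<in> unit_cube. col y = j}"
  have fin: "finite (SIGMA i:UNIV. Z i)" using Z by (intro finite_SigmaI) auto
  have "s ` ?A \<subseteq> Pow (SIGMA i:UNIV. Z i)" by (auto simp: s_def)
  then have "finite (s ` ?A)" using fin by (meson finite_Pow_iff finite_subset)
  moreover have "unit_cube \<inter> (\<Inter>(i, z)\<in>(SIGMA i:UNIV. Z i). {y. (y $ i < z) = ((i, z) \<in> P)}) \<in> sets lebesgue" (is "?B P \<in> _") for P
  proof -
    have "open {y :: real ^ 'd. y $ i < z}" for i z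
      by (intro open_Collect_less continuous_intros)
    then have "{y :: real ^ 'd. y $ i < z} \<in> sets lebesgue" "- {y :: real ^ 'd. y $ i < z} \<in> sets lebesgue" for i z
      by (simp_all add: borel_open borel_closed closed_Compl)
    moreover have "{y :: real ^ 'd. (y $ i < z) = b} = (if b then {y. y $ i < z} else - {y. y $ i < z})" for i z b
      by auto
    ultimately have "{y :: real ^ 'd. (y $ i < z) = b} \<in> sets lebesgue" for i z b by simp
    then show ?thesis using fin
      by (cases "(SIGMA i:UNIV. Z i) = {}") (auto intro!: sets.Int sets_unit_cube sets.finite_INT)
  qed
  ultimately have "(\<Union>P\<in>s ` ?A. ?B P) \<in> sets lebesgue" by (intro sets.finite_UN) auto
  also have "(\<Union>P\<in>s ` ?A. ?B P) = ?A"
  proof (intro equalityI subsetI)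
    fix y assume "y \<in> (\<Union>P\<in>s ` ?A. ?B P)"
    then obtain y' where y': "y' \<in> unit_cube" "col y' = j" "y \<in> unit_cube"
      and "\<forall>i. \<forall>z\<in>Z i. (y $ i < z) = ((i, z) \<in> s y')" by auto
    then have "\<forall>i. \<forall>z\<in>Z i. (y $ i < z) = (y' $ i < z)" by (simp add: s_def)
    then show "y \<in> ?A" using col y' unfolding determined_def by blast
  next
    fix y assume "y \<in> ?A"
    then show "y \<in> (\<Union>P\<in>s ` ?A. ?B P)" by (intro UN_I[of "s y"]) (auto simp: s_def)
  qed
  finally show ?thesis .
qed

section \<open>Points of the join as successive cuts of the cube\<close>

definition mass :: "nat \<Rightarrow> (nat \<times> nat \<Rightarrow> real) \<Rightarrow> nat \<Rightarrow> real" where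
  "mass p x j = (\<Sum>a<p. x (j, a))"

text \<open>The lowest vertex of the box left after \<open>J\<close> cuts. Because of the factor
  \<open>CARD('d)\<close>, after \<open>N + 1\<close> cuts of total weight 1 the coordinates sum to
  the dimension, so that one of them is at least 1. By way of \<open>mass\<close> the corner is
  independent of the colours.\<close>

definition corner :: "(nat \<Rightarrow> 'd) \<Rightarrow> nat \<Rightarrow> (nat \<times> nat \<Rightarrow> real) \<Rightarrow> nat \<Rightarrow> real ^ 'd" where
  "corner dir p x J = (\<Sum>j<J. axis (dir j) (real CARD('d) * mass p x j))"

text \<open>What colour \<open>a\<close> receives from piece \<open>j\<close>: if the piece has
  another colour, then \<open>x (j, a) = 0\<close> and the two boxes coincide. As no choice of
  colouring enters, the expression is continuous across all faces.\<close>

definition piece_mass ::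
  "(real ^ 'd \<Rightarrow> real) \<Rightarrow> (nat \<Rightarrow> 'd) \<Rightarrow> nat \<Rightarrow> nat \<times> nat \<Rightarrow> (nat \<times> nat \<Rightarrow> real) \<Rightarrow> real" where
  "piece_mass f dir p = (\<lambda>(j, a) x. upper_mass f (corner dir p x j) -
     upper_mass f (corner dir p x j + axis (dir j) (real CARD('d) * x (j, a))))"

lemma mass_face:
  assumes "x \<in> face c N" "\<And>j. c j < p"
  shows "mass p x j = x (j, c j)"
proof -
  have "mass p x j = (\<Sum>a<p. if a = c j then x (j, c j) else 0)"
    unfolding mass_def using faceD(2)[OF assms(1)] by (intro sum.cong) auto
  then show ?thesis using assms(2)[of j] by simp
qed

lemma mass_rot:
  assumes "0 < p"
  shows "mass p (rot p x) j = mass p x j"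
proof -
  have "mass p (rot p x) j = (\<Sum>a<p. rot p x (j, Suc a mod p))"
    unfolding mass_def
  proof (rule sum.reindex_bij_betw[symmetric])
    show "bij_betw (\<lambda>b. Suc b mod p) {..<p} {..<p}"
      using assms by (intro bij_betw_imageI endo_inj_surj inj_on_Suc_mod) auto
  qed
  also have "\<dots> = mass p x j"
    unfolding mass_def
  proof (intro sum.cong refl)
    fix a assume "a \<in> {..<p}"
    then show "rot p x (j, Suc a mod p) = x (j, a)"
      using rot_color_shift[OF assms, of x "(j, a)"] by (simp add: color_shift_def)
  qed
  finally show ?thesis .
qed

lemma piece_mass_rot:
  assumes p: "0 < p" and a: "a < p"
  shows "piece_mass f dir p (j, Suc a mod p) (rot p x) = piece_mass f dir p (j, a) x"
proof -
  have "corner dir p (rot p x) j = corner dir p x j"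
    by (simp add: corner_def mass_rot[OF p])
  moreover have "rot p x (j, Suc a mod p) = x (j, a)"
    using rot_color_shift[OF p, of x "(j, a)"] a by (simp add: color_shift_def)
  ultimately show ?thesis by (simp add: piece_mass_def)
qed

lemma continuous_on_axis [continuous_intros]:
  assumes "continuous_on A f"
  shows "continuous_on A (\<lambda>x. axis k (f x) :: real ^ 'd)"
  unfolding axis_def
proof (rule continuous_on_vec_lambda)
  show "continuous_on A (\<lambda>x. if i = k then f x else 0)" for i
    using assms by (cases "i = k") (simp_all add: continuous_on_const)
qed

lemma continuous_piece_mass:
  fixes f :: "real ^ 'd \<Rightarrow> real"
  assumes "integrable lebesgue f"
  shows "continuous_on A (piece_mass f dir p l)"
proof -
  obtain j a where l: "l = (j, a)" by (cases l)
  have coord: "continuous_on A (\<lambda>x. x m)" for m :: "nat \<times> nat"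
    by (rule continuous_on_subset[OF continuous_on_product_coordinates subset_UNIV])
  have c: "continuous_on A (\<lambda>x. corner dir p x j)"
    unfolding corner_def mass_def by (intro continuous_intros coord)
  have "continuous_on A (\<lambda>x. upper_mass f (g x))" if "continuous_on A g" for g
    by (rule continuous_on_compose2[OF continuous_upper_mass[OF assms] that]) auto
  note um = this
  show ?thesis
    unfolding l piece_mass_def prod.case by (intro continuous_on_diff um continuous_intros coord c)
qed

lemma piece_mass_face:
  fixes f :: "real ^ 'd \<Rightarrow> real"
  assumes x: "x \<in> face c N" and c: "\<And>j. c j < p"
  shows "piece_mass f dir p (j, a) x =
    (if c j = a then upper_mass f (corner dir p x j) - upper_mass f (corner dir p x (Suc j)) else 0)"
proof (cases "c j = a")
  case True
  then show ?thesis using mass_face[OF x c, of j] by (simp add: piece_mass_def corner_def)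
next
  case False
  then have "x (j, a) = 0" using faceD(2)[OF x, of j a] by auto
  then have "corner dir p x j + axis (dir j) (real CARD('d) * x (j, a)) = corner dir p x j"
    by (simp add: vec_eq_iff axis_def)
  note eq = this
  show ?thesis using False unfolding piece_mass_def prod.case eq by simp
qed

lemma corner_nth: "corner dir p x J $ i = (\<Sum>j | j < J \<and> dir j = i. real CARD('d) * mass p x j)"
  for dir :: "nat \<Rightarrow> 'd :: finite"
proof -
  have "corner dir p x J $ i = (\<Sum>j<J. if dir j = i then real CARD('d) * mass p x j else 0)"
    unfolding corner_def by (auto simp: axis_def intro!: sum.cong)
  also have "\<dots> = (\<Sum>j | j < J \<and> dir j = i. real CARD('d) * mass p x j)"
    by (subst sum.inter_filter[symmetric]) auto
  finally show ?thesis .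
qed

text \<open>Each step moves the corner in the single direction \<open>dir J\<close> and never
  backwards, so lying above the corner means having passed every cut.\<close>

lemma upper_corner_iff:
  fixes dir :: "nat \<Rightarrow> 'd :: finite"
  assumes x: "\<And>l. 0 \<le> x l" and y: "y \<in> unit_cube"
  shows "y \<in> upper (corner dir p x J) \<longleftrightarrow> (\<forall>j<J. corner dir p x (Suc j) $ dir j \<le> y $ dir j)"
proof (induction J)
  case 0
  then show ?case using y by (simp add: upper_def corner_def mem_unit_cube)
next
  case (Suc J)
  have m: "0 \<le> mass p x j" for j unfolding mass_def using x by (intro sum_nonneg) auto
  have nth: "corner dir p x (Suc J) $ i = corner dir p x J $ i + (if i = dir J then real CARD('d) * mass p x J else 0)" for i
    by (simp add: corner_def axis_def)
  have "y \<in> upper (corner dir p x (Suc J)) \<longleftrightarrow>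
      y \<in> upper (corner dir p x J) \<and> corner dir p x (Suc J) $ dir J \<le> y $ dir J"
  proof
    assume R: "y \<in> upper (corner dir p x (Suc J))"
    have "corner dir p x J $ i \<le> corner dir p x (Suc J) $ i" for i using m nth by simp
    then show "y \<in> upper (corner dir p x J) \<and> corner dir p x (Suc J) $ dir J \<le> y $ dir J"
      using R order_trans unfolding upper_def by blast
  next
    assume R: "y \<in> upper (corner dir p x J) \<and> corner dir p x (Suc J) $ dir J \<le> y $ dir J"
    have "corner dir p x (Suc J) $ i \<le> y $ i" for i
      using R nth[of i] by (cases "i = dir J") (auto simp: upper_def)
    then show "y \<in> upper (corner dir p x (Suc J))" by (simp add: upper_def)
  qed
  then show ?case using Suc by (auto simp: less_Suc_eq)
qed

text \<open>The coordinates of the last corner have sum \<open>CARD('d)\<close>, so one of them is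
  at least 1, and the remaining box meets the cube at most in the facet where this coordinate is
  1.\<close>

lemma upper_corner_null:
  fixes f :: "real ^ 'd \<Rightarrow> real"
  assumes x: "x \<in> face c N" and c: "\<And>j. c j < p" and f: "\<And>y. y \<notin> unit_cube \<Longrightarrow> f y = 0"
  shows "AE y in lebesgue. f y * indicator (upper (corner dir p x (Suc N))) y = 0"
proof -
  let ?v = "corner dir p x (Suc N)"
  have "(\<Sum>i\<in>UNIV. ?v $ i) = (\<Sum>j\<le>N. real CARD('d) * mass p x j)"
    unfolding corner_def sum_component
    by (subst sum.swap) (simp add: axis_def lessThan_Suc_atMost)
  also have "\<dots> = real CARD('d)"
    using faceD(3)[OF x] by (simp add: mass_face[OF x c] flip: sum_distrib_left)
  finally have sum: "(\<Sum>i\<in>UNIV. ?v $ i) = (\<Sum>i\<in>(UNIV :: 'd set). 1)" by simp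
  have "\<exists>i. 1 \<le> ?v $ i"
  proof (rule ccontr)
    assume "\<not> ?thesis"
    then have "(\<Sum>i\<in>UNIV. ?v $ i) < (\<Sum>i\<in>(UNIV :: 'd set). 1)"
      by (intro sum_strict_mono) (auto simp: not_le)
    then show False using sum by simp
  qed
  then obtain i where i: "1 \<le> ?v $ i" by blast
  show ?thesis
    using AE_coordinate_neq[of i 1]
  proof eventually_elim
    case (elim y)
    have "y \<notin> upper ?v" if "y \<in> unit_cube"
    proof
      assume "y \<in> upper ?v"
      then have "1 \<le> y $ i" using i order_trans unfolding upper_def by blast
      then show False using elim that by (simp add: mem_unit_cube dual_order.antisym)
    qed
    then show ?case using f[of y] by (cases "y \<in> unit_cube") auto
  qed
qed

lemma integrable_indicator_mult:
  fixes f :: "'a \<Rightarrow> real"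
  assumes "integrable M f" "A \<in> sets M"
  shows "integrable M (\<lambda>y. f y * indicator A y)"
  using integrable_real_mult_indicator[OF assms(2,1)] by (simp add: mult.commute)

lemma card_dir: "card {j. j < length ds \<and> ds ! j = i} = count_list ds i"
  by (simp add: count_list_eq_length_filter length_filter_conv_card eq_commute)

text \<open>The pieces are cut off one after the other: the \<open>j\<close>-th cut removes the points of the remaining
  box \<open>upper (corner dir p x j)\<close> below a hyperplane perpendicular to direction \<open>dir j\<close>. The last cut
  leaves a null set, so that it is not needed; it only makes all pieces look alike.\<close>

lemma split_prime:
  fixes f :: "nat \<Rightarrow> real ^ 'd \<Rightarrow> real"
  assumes p: "prime p" and f: "densities n f" and len: "length ds = n * (p - 1)"
  shows "\<exists>Z col. split_by Z col f n p ds"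
proof -
  define N where "N = n * (p - 1)"
  have p0: "0 < p" using p by (simp add: prime_gt_0_nat)
  \<comment> \<open>There are \<open>N + 1\<close> pieces but \<open>N\<close> prescribed
    directions; that of the last cut is arbitrary.\<close>
  define dir where "dir = (\<lambda>j. if j < N then ds ! j else undefined)"
  \<comment> \<open>Densities of index \<open>n\<close> and above are set to 0 to make
    \<open>F l\<close> continuous for every label \<open>l\<close>.\<close>
  define g where "g = (\<lambda>i. if i < n then f i else (\<lambda>_. 0))"
  have g: "integrable lebesgue (g i)" "y \<notin> unit_cube \<Longrightarrow> g i y = 0" for i y
    using f by (auto simp: g_def densities_def)
  define F where "F = (\<lambda>(i, a) x. \<Sum>j\<le>N. piece_mass (g i) dir p (j, a) x)"
  have "\<exists>x\<in>color_join p N. \<forall>i<n. \<forall>a<p. \<forall>b<p. F (i, a) x = F (i, b) x"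
  proof (rule equivariant_balanced_point[OF p N_def])
    show "continuous_on (color_join p N) (F l)" for l
      unfolding F_def by (cases l) (auto intro!: continuous_on_sum continuous_piece_mass g)
    show "F (color_shift p l) (rot p x) = F l x" if "l \<in> {..<n} \<times> {..<p}" for l x
      using that by (cases l) (auto simp: F_def color_shift_def piece_mass_rot[OF p0])
  qed
  then obtain c x where c: "\<And>j. c j < p" and x: "x \<in> face c N"
    and bal: "\<And>i a b. i < n \<Longrightarrow> a < p \<Longrightarrow> b < p \<Longrightarrow> F (i, a) x = F (i, b) x"
    unfolding color_join_def by blast
  define v where "v = corner dir p x"
  define below where "below = (\<lambda>j (y :: real ^ 'd). y $ dir j < v (Suc j) $ dir j)"
  \<comment> \<open>The number of the piece containing \<open>y\<close>: the first cut that removes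
    \<open>y\<close>, or \<open>N\<close> if none of the first \<open>N\<close> does.\<close>
  define J where "J = (\<lambda>y. LEAST j. j = N \<or> j < N \<and> below j y)"
  \<comment> \<open>Cuts beyond 1 have the whole cube below them and are dropped.\<close>
  define Z where "Z = (\<lambda>i. {v (Suc j) $ i | j. j < N \<and> dir j = i} \<inter> {0..1})"
  have upper: "y \<in> upper (v j) \<longleftrightarrow> (\<forall>j'<j. \<not> below j' y)" if "y \<in> unit_cube" for y j
    unfolding v_def below_def using upper_corner_iff[of x y dir p j, OF faceD(1)[OF x] that] by (simp add: not_less)
  have J: "J y \<le> N" "y \<in> upper (v j) \<longleftrightarrow> j \<le> J y" if "y \<in> unit_cube" "j \<le> N" for y j
  proof -
    show "J y \<le> N" unfolding J_def by (rule Least_le) simp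
    have "J y = N \<or> J y < N \<and> below (J y) y"
      unfolding J_def by (rule LeastI[of _ N]) simp
    moreover have "\<not> below j' y" if "j' < J y" for j'
      using not_less_Least[of j' "\<lambda>j. j = N \<or> j < N \<and> below j y"] that \<open>J y \<le> N\<close> unfolding J_def by auto
    ultimately show "y \<in> upper (v j) \<longleftrightarrow> j \<le> J y"
      unfolding upper[OF that(1)] using that(2) by (metis leD leI less_le_trans)
  qed
  have det: "determined Z (c \<circ> J)"
    unfolding determined_def
  proof (intro ballI impI)
    fix y y' :: "real ^ 'd" assume y: "y \<in> unit_cube" "y' \<in> unit_cube"
      and same: "\<forall>i. \<forall>z\<in>Z i. (y $ i < z) = (y' $ i < z)"
    have "below j y = below j y'" if "j < N" for j
    proof (cases "v (Suc j) $ dir j \<le> 1")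
      case True
      have "0 \<le> v (Suc j) $ dir j"
        unfolding v_def corner_nth mass_def using faceD(1)[OF x] by (intro sum_nonneg mult_nonneg_nonneg) auto
      then have "v (Suc j) $ dir j \<in> Z (dir j)" using True that unfolding Z_def by auto
      then show ?thesis using same unfolding below_def by blast
    next
      case False
      have "y $ dir j \<le> 1" "y' $ dir j \<le> 1" using y by (simp_all add: mem_unit_cube)
      then show ?thesis using False unfolding below_def by linarith
    qed
    then have "(\<lambda>j. j = N \<or> j < N \<and> below j y) = (\<lambda>j. j = N \<or> j < N \<and> below j y')" by auto
    then show "(c \<circ> J) y = (c \<circ> J) y'" unfolding J_def comp_def by simp
  qed
  have Z: "finite (Z i) \<and> Z i \<subseteq> {0..1} \<and> card (Z i) \<le> count_list ds i" for i
  proof -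
    have sub: "Z i \<subseteq> (\<lambda>j. v (Suc j) $ i) ` {j. j < length ds \<and> ds ! j = i}"
      unfolding Z_def using len by (auto simp: dir_def N_def)
    then have "card (Z i) \<le> card {j. j < length ds \<and> ds ! j = i}"
      by (rule surj_card_le[rotated]) simp
    then show ?thesis using finite_subset[OF sub] by (auto simp: card_dir Z_def)
  qed
  have "(LINT y|lebesgue. f i y * indicator {y \<in> unit_cube. (c \<circ> J) y = a} y) =
      (LINT y|lebesgue. f i y) / p" if i: "i < n" and a: "a < p" for i a
  proof -
    have fi: "integrable lebesgue (f i)" "y \<notin> unit_cube \<Longrightarrow> f i y = 0" for y
      using f i by (auto simp: densities_def)
    have null: "AE y in lebesgue. f i y * indicator (upper (v (Suc N))) y = 0"
      unfolding v_def by (rule upper_corner_null[OF x c fi(2)])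
    let ?I = "\<lambda>j y. f i y * indicator (upper (v j)) y"
    have int: "integrable lebesgue (?I j)" for j
      by (rule integrable_indicator_mult[OF fi(1) sets_upper])
    have int_if: "integrable lebesgue (\<lambda>y. if c j = a then ?I j y - ?I (Suc j) y else 0)" for j
      using Bochner_Integration.integrable_diff[OF int[of j] int[of "Suc j"]] by (cases "c j = a") simp_all
    have mass: "F (i, b) x = (\<Sum>j\<le>N. if c j = b then upper_mass (f i) (v j) - upper_mass (f i) (v (Suc j)) else 0)" for b
      unfolding v_def using i by (simp add: F_def g_def piece_mass_face[OF x c])
    have "(LINT y|lebesgue. f i y * indicator {y \<in> unit_cube. (c \<circ> J) y = a} y) =
        (LINT y|lebesgue. (\<Sum>j\<le>N. if c j = a then ?I j y - ?I (Suc j) y else 0))"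
    proof (rule integral_cong_AE)
      have "{y \<in> unit_cube. (c \<circ> J) y = a} \<in> sets lebesgue"
        using Z by (intro sets_determined[OF _ det]) blast
      then show "(\<lambda>y. f i y * indicator {y \<in> unit_cube. (c \<circ> J) y = a} y) \<in> borel_measurable lebesgue"
        by (intro borel_measurable_integrable integrable_indicator_mult fi(1))
      show "(\<lambda>y. \<Sum>j\<le>N. if c j = a then ?I j y - ?I (Suc j) y else 0) \<in> borel_measurable lebesgue"
        by (intro borel_measurable_integrable Bochner_Integration.integrable_sum int_if)
      show "AE y in lebesgue. f i y * indicator {y \<in> unit_cube. (c \<circ> J) y = a} y =
          (\<Sum>j\<le>N. if c j = a then ?I j y - ?I (Suc j) y else 0)"
        using null
      proof eventually_elim
        case (elim y)
        show ?case
        proof (cases "y \<in> unit_cube")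
          case True
          \<comment> \<open>A piece is the difference of two successive boxes; for the last piece
            the second term vanishes at \<open>y\<close> by \<open>null\<close>.\<close>
          have "?I j y - ?I (Suc j) y = (if j = J y then f i y else 0)" if "j \<le> N" for j
          proof (cases "j = N")
            case True
            then show ?thesis using elim J[OF \<open>y \<in> unit_cube\<close>, of N] by (auto simp: indicator_def)
          next
            case False
            then show ?thesis using that J(2)[OF True, of j] J(2)[OF True, of "Suc j"]
              by (auto simp: indicator_def)
          qed
          then have "(\<Sum>j\<le>N. if c j = a then ?I j y - ?I (Suc j) y else 0) =
              (\<Sum>j\<le>N. if j = J y then (if c (J y) = a then f i y else 0) else 0)"
            by (intro sum.cong) auto
          then show ?thesis using J(1)[OF True, of N] True by (simp add: indicator_def)
        qed (simp add: fi(2) cong: if_cong)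
      qed
    qed
    also have "\<dots> = (\<Sum>j\<le>N. (LINT y|lebesgue. (if c j = a then ?I j y - ?I (Suc j) y else 0)))"
      by (intro Bochner_Integration.integral_sum int_if)
    also have "\<dots> = F (i, a) x"
      unfolding mass upper_mass_def
      by (intro sum.cong refl) (simp add: Bochner_Integration.integral_diff[OF int int] del: Bochner_Integration.integral_diff)
    finally have F: "(LINT y|lebesgue. f i y * indicator {y \<in> unit_cube. (c \<circ> J) y = a} y) = F (i, a) x" .
    \<comment> \<open>Summed over all colours the pieces telescope to the whole mass; the
      \<open>p\<close> summands being equal, each is a \<open>p\<close>-th part.\<close>
    have "(\<Sum>b<p. F (i, b) x) = (\<Sum>j\<le>N. upper_mass (f i) (v j) - upper_mass (f i) (v (Suc j)))"
      unfolding mass using c by (subst sum.swap) simp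
    also have "\<dots> = upper_mass (f i) (v 0) - upper_mass (f i) (v (Suc N))"
      by (rule sum_telescope)
    also have "upper_mass (f i) (v (Suc N)) = 0"
      unfolding upper_mass_def using null by (rule integral_eq_zero_AE)
    also have "upper_mass (f i) (v 0) = (LINT y|lebesgue. f i y)"
      unfolding upper_mass_def
    proof (intro Bochner_Integration.integral_cong refl)
      show "f i y * indicator (upper (v 0)) y = f i y" for y
        using upper[of y 0] fi(2)[of y] by (cases "y \<in> unit_cube") auto
    qed
    finally have "(\<Sum>b<p. F (i, b) x) = (LINT y|lebesgue. f i y)" by simp
    moreover have "(\<Sum>b<p. F (i, b) x) = (\<Sum>b<p. F (i, a) x)"
      using bal[OF i _ a] by (intro sum.cong) auto
    ultimately show ?thesis unfolding F using p0 by (simp add: field_simps)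
  qed
  then show ?thesis
    unfolding split_by_def using c det Z by (intro exI[of _ Z] exI[of _ "c \<circ> J"]) simp
qed

section \<open>From primes to all numbers of colours\<close>

lemma count_list_take_drop_sum:
  "length xs = q * L \<Longrightarrow> (\<Sum>a<q. count_list (take L (drop (a * L) xs)) i) = count_list xs i"
proof (induction q arbitrary: xs)
  case (Suc q)
  have "(\<Sum>a<Suc q. count_list (take L (drop (a * L) xs)) i) =
      count_list (take L xs) i + (\<Sum>a<q. count_list (take L (drop (a * L) (drop L xs))) i)"
    by (simp add: sum.lessThan_Suc_shift add.commute del: sum.lessThan_Suc)
  also have "\<dots> = count_list (take L xs) i + count_list (drop L xs) i"
    using Suc.prems by (subst Suc.IH) auto
  also have "\<dots> = count_list (take L xs @ drop L xs) i" by (simp only: count_list_append)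
  finally show ?case by simp
qed simp

text \<open>The first \<open>n * (p - 1)\<close> directions serve the prime splitting; the rest is
  dealt out in \<open>p\<close> blocks of length \<open>L\<close>, one for each colour class. A cut
  made for one class runs through the whole cube, which is harmless because
  \<open>determined\<close> tolerates additional cuts.\<close>

lemma split_mult:
  fixes f :: "nat \<Rightarrow> real ^ 'd \<Rightarrow> real"
  assumes p: "prime p" and q: "1 \<le> q"
    and IH: "\<And>f (ds :: 'd list). densities n f \<Longrightarrow> length ds = n * (q - 1) \<Longrightarrow> \<exists>Z col. split_by Z col f n q ds"
    and f: "densities n f" and len: "length ds = n * (p * q - 1)"
  shows "\<exists>Z col. split_by Z col f n (p * q) ds"
proof -
  have p0: "0 < p" using p by (simp add: prime_gt_0_nat)
  define L where "L = n * (q - 1)"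
  define ds0 where "ds0 = take (n * (p - 1)) ds"
  define ds1 where "ds1 = drop (n * (p - 1)) ds"
  have "p * q - 1 = (p - 1) + p * (q - 1)"
    using p0 q by (cases p; cases q) simp_all
  then have len': "length ds = n * (p - 1) + p * L" unfolding len L_def by (simp add: algebra_simps)
  have len0: "length ds0 = n * (p - 1)" and len1: "length ds1 = p * L"
    using len' by (simp_all add: ds0_def ds1_def)
  obtain Z0 col0 where Z0: "\<forall>i. finite (Z0 i) \<and> Z0 i \<subseteq> {0..1} \<and> card (Z0 i) \<le> count_list ds0 i"
    and det0: "determined Z0 col0" and col0: "\<forall>y. col0 y < p"
    and eq0: "\<forall>i<n. \<forall>j<p. (LINT y|lebesgue. f i y * indicator {y \<in> unit_cube. col0 y = j} y) = (LINT y|lebesgue. f i y) / p"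
    using split_prime[OF p f len0] unfolding split_by_def by blast
  let ?A = "\<lambda>a. {y \<in> unit_cube. col0 y = a}"
  have "?A a \<in> sets lebesgue" for a using Z0 by (intro sets_determined[OF _ det0]) blast
  then have dens: "densities n (\<lambda>i y. f i y * indicator (?A a) y)" for a
    using f unfolding densities_def by (auto intro: integrable_indicator_mult)
  define R where "R = (\<lambda>a Z col. split_by Z col (\<lambda>i y. f i y * indicator (?A a) y) n q (take L (drop (a * L) ds1)))"
  have "\<exists>Z col. R a Z col" if "a < p" for a
  proof -
    have "a * L + L \<le> p * L" using mult_le_mono1[of "Suc a" p L] that by simp
    then have "length (take L (drop (a * L) ds1)) = L" using len1 by simp
    then show ?thesis unfolding L_def R_def by (intro IH dens)
  qed
  then obtain Z col where R: "\<forall>a<p. R a (Z a) (col a)" by metis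
  have Z: "\<forall>a\<in>{..<p}. \<forall>i. finite (Z a i) \<and> Z a i \<subseteq> {0..1} \<and>
      card (Z a i) \<le> count_list (take L (drop (a * L) ds1)) i"
    and det: "\<forall>a\<in>{..<p}. determined (Z a) (col a)" and col: "\<forall>a\<in>{..<p}. \<forall>y. col a y < q"
    and eq: "\<forall>a\<in>{..<p}. \<forall>i<n. \<forall>b<q.
      (LINT y|lebesgue. f i y * indicator (?A a) y * indicator {y \<in> unit_cube. col a y = b} y) =
      (LINT y|lebesgue. f i y * indicator (?A a) y) / q"
    using R unfolding R_def split_by_def by simp_all
  define W where "W = (\<lambda>i. Z0 i \<union> (\<Union>a<p. Z a i))"
  \<comment> \<open>The two colours are coded as the digits of a number, recovered by division by
    \<open>q\<close>.\<close>
  define w where "w = (\<lambda>y. col0 y * q + col (col0 y) y)"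
  have w_div: "w y div q = col0 y" "w y mod q = col (col0 y) y" for y
    using col col0 q unfolding w_def by (simp_all add: div_mult_self3 mod_mult_self3)
  have "finite (W i) \<and> W i \<subseteq> {0..1} \<and> card (W i) \<le> count_list ds i" for i
  proof -
    have "card (W i) \<le> card (Z0 i) + card (\<Union>a<p. Z a i)" unfolding W_def by (rule card_Un_le)
    also have "card (\<Union>a<p. Z a i) \<le> (\<Sum>a<p. card (Z a i))" by (rule card_UN_le) simp
    also have "\<dots> \<le> (\<Sum>a<p. count_list (take L (drop (a * L) ds1)) i)" using Z by (intro sum_mono) blast
    also have "\<dots> = count_list ds1 i" by (rule count_list_take_drop_sum[OF len1])
    also have "card (Z0 i) \<le> count_list ds0 i" using Z0 by blast
    also have "count_list ds0 i + count_list ds1 i = count_list ds i"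
      unfolding ds0_def ds1_def by (simp flip: count_list_append)
    finally have "card (W i) \<le> count_list ds i" by simp
    moreover have "Z a i \<subseteq> {0..1}" "finite (Z a i)" if "a < p" for a using Z that by blast+
    ultimately show ?thesis using Z0 unfolding W_def by (simp add: UN_subset_iff)
  qed
  moreover have "determined W w"
    unfolding determined_def
  proof (intro ballI impI)
    fix y y' :: "real ^ 'd" assume y: "y \<in> unit_cube" "y' \<in> unit_cube"
      and same: "\<forall>i. \<forall>z\<in>W i. (y $ i < z) = (y' $ i < z)"
    have "col0 y = col0 y'" using det0 y same unfolding determined_def W_def by blast
    moreover have "col a y = col a y'" if "a < p" for a
    proof -
      have "\<forall>i. \<forall>z\<in>Z a i. (y $ i < z) = (y' $ i < z)" using same that unfolding W_def by blast
      then show ?thesis using det y that unfolding determined_def by blast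
    qed
    ultimately show "w y = w y'" using col0 unfolding w_def by metis
  qed
  moreover have "w y < p * q" for y
  proof -
    have "w y < Suc (col0 y) * q" using col col0 unfolding w_def by simp
    also have "\<dots> \<le> p * q" using col0 by (intro mult_le_mono1) (simp add: Suc_leI)
    finally show ?thesis .
  qed
  moreover have "(LINT y|lebesgue. f i y * indicator {y \<in> unit_cube. w y = j} y) = (LINT y|lebesgue. f i y) / (p * q)"
    if i: "i < n" and j: "j < p * q" for i j
  proof -
    define a b where "a = j div q" and "b = j mod q"
    have a: "a < p" and b: "b < q" using j q by (simp_all add: a_def b_def less_mult_imp_div_less)
    have "w y = j \<longleftrightarrow> col0 y = a \<and> col a y = b" for y
      using w_div[of y] unfolding a_def b_def by (metis div_mult_mod_eq)
    then have "(\<lambda>y. f i y * indicator {y \<in> unit_cube. w y = j} y) =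
        (\<lambda>y. f i y * indicator (?A a) y * indicator {y \<in> unit_cube. col a y = b} y)"
      by (auto simp: fun_eq_iff indicator_def)
    then have "(LINT y|lebesgue. f i y * indicator {y \<in> unit_cube. w y = j} y) =
        (LINT y|lebesgue. f i y * indicator (?A a) y) / q"
      using eq a b i by simp
    also have "\<dots> = (LINT y|lebesgue. f i y) / p / q" using eq0 a i by simp
    finally show ?thesis by simp
  qed
  ultimately show ?thesis unfolding split_by_def by (intro exI[of _ W] exI[of _ w]) auto
qed

theorem split_general:
  fixes f :: "nat \<Rightarrow> real ^ 'd \<Rightarrow> real"
  assumes "1 \<le> k" "densities n f" "length ds = n * (k - 1)"
  shows "\<exists>Z col. split_by Z col f n k ds"
  using assms
proof (induction k arbitrary: f ds rule: less_induct)
  case (less k)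
  show ?case
  proof (cases "k = 1")
    case True
    have "(LINT y|lebesgue. f i y * indicator unit_cube y) = (LINT y|lebesgue. f i y)" if "i < n" for i
      using less.prems(2) that unfolding densities_def
      by (intro Bochner_Integration.integral_cong refl) (auto simp: indicator_def)
    then show ?thesis unfolding split_by_def determined_def using True
      by (intro exI[of _ "\<lambda>_. {}"] exI[of _ "\<lambda>_. 0"]) auto
  next
    case False
    then obtain p where p: "prime p" "p dvd k" using prime_factor_nat by blast
    then obtain q where k: "k = p * q" by (elim dvdE)
    have q: "1 \<le> q" using less.prems(1) k by (cases q) auto
    then have "q < k" using k prime_gt_1_nat[OF p(1)] by simp
    then show ?thesis
      unfolding k using less.prems(2,3) k q by (intro split_mult p less.IH) auto
  qed
qed

section \<open>Hyperplanes, cells and the given measures\<close>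

lemma ex_list_count:
  fixes m :: "'d :: finite \<Rightarrow> nat"
  obtains ds where "length ds = (\<Sum>i\<in>UNIV. m i)" "\<And>i. count_list ds i = m i"
proof -
  have "\<exists>ds. length ds = (\<Sum>i\<in>A. m i) \<and> (\<forall>i. count_list ds i = (if i \<in> A then m i else 0))"
    if "finite A" for A :: "'d set"
    using that
  proof (induction A)
    case (insert j A)
    then obtain ds where ds: "length ds = (\<Sum>i\<in>A. m i)" "\<forall>i. count_list ds i = (if i \<in> A then m i else 0)"
      by blast
    have "count_list (replicate q j) i = (if i = j then q else 0)" for q i
      by (induction q) auto
    then show ?case using insert.hyps ds
      by (intro exI[of _ "replicate (m j) j @ ds"]) auto
  qed simp
  from this[of UNIV] that show ?thesis by auto
qed

text \<open>Extending the density by 0 turns a measure on the cube into an integral over the whole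
  space, where restriction to a colour class is multiplication by an indicator.\<close>

lemma continuous_prob_measure_density:
  fixes M :: "(real ^ 'd) measure"
  assumes "continuous_prob_measure M"
  obtains f where "integrable lebesgue f" "\<And>y. y \<notin> unit_cube \<Longrightarrow> f y = 0" "(LINT y|lebesgue. f y) = 1"
    "\<And>A. A \<in> sets lebesgue \<Longrightarrow> A \<subseteq> unit_cube \<Longrightarrow> measure M A = (LINT y|lebesgue. f y * indicator A y)"
proof -
  obtain g :: "real ^ 'd \<Rightarrow> real" where g [measurable]: "g \<in> borel_measurable (lebesgue_on unit_cube)"
    and g0: "\<And>x. x \<in> unit_cube \<Longrightarrow> 0 \<le> g x"
    and M: "M = density (lebesgue_on unit_cube) (\<lambda>x. ennreal (g x))" and prob: "prob_space M"
    using assms unfolding continuous_prob_measure_def by blast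
  define f where "f = (\<lambda>y. if y \<in> unit_cube then g y else 0)"
  have f [measurable]: "f \<in> borel_measurable lebesgue"
    unfolding f_def using g sets_unit_cube by (simp add: borel_measurable_if)
  have f0: "0 \<le> f y" for y using g0 by (simp add: f_def)
  have em: "emeasure M A = (\<integral>\<^sup>+ y. ennreal (f y * indicator A y) \<partial>lebesgue)"
    if A: "A \<in> sets lebesgue" "A \<subseteq> unit_cube" for A
  proof -
    have "A \<in> sets (lebesgue_on unit_cube)" using A by (simp add: sets_restrict_space_iff)
    then have "emeasure M A = (\<integral>\<^sup>+ y. ennreal (g y) * indicator A y \<partial>lebesgue_on unit_cube)"
      unfolding M by (intro emeasure_density) auto
    also have "\<dots> = (\<integral>\<^sup>+ y. ennreal (g y) * indicator A y * indicator unit_cube y \<partial>lebesgue)"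
      by (subst nn_integral_restrict_space) auto
    also have "\<dots> = (\<integral>\<^sup>+ y. ennreal (f y * indicator A y) \<partial>lebesgue)"
      by (intro nn_integral_cong) (auto simp: f_def indicator_def)
    finally show ?thesis .
  qed
  have "space M = unit_cube" unfolding M by (simp add: space_restrict_space)
  then have "emeasure M unit_cube = 1" using prob_space.emeasure_space_1[OF prob] by simp
  moreover have "f y * indicator unit_cube y = f y" for y by (simp add: f_def)
  ultimately have one: "(\<integral>\<^sup>+ y. ennreal (f y) \<partial>lebesgue) = 1"
    using em[OF sets_unit_cube order_refl] by simp
  have int: "integrable lebesgue f"
    using one f0 by (intro integrableI_nonneg) auto
  show ?thesis
  proof (rule that[OF int])
    show "f y = 0" if "y \<notin> unit_cube" for y using that by (simp add: f_def)
    show "(LINT y|lebesgue. f y) = 1"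
      using one f0 by (simp add: integral_eq_nn_integral)
    fix A :: "(real ^ 'd) set" assume A: "A \<in> sets lebesgue" "A \<subseteq> unit_cube"
    show "measure M A = (LINT y|lebesgue. f y * indicator A y)"
      unfolding measure_def em[OF A] using A(1) f0 by (intro integral_eq_nn_integral[symmetric]) auto
  qed
qed

text \<open>By the intermediate value theorem, a change of side inside \<open>c\<close> would
  produce a point with coordinate \<open>z\<close>.\<close>

lemma connected_same_side:
  fixes c :: "(real ^ 'd) set"
  assumes "connected c" "\<And>y. y \<in> c \<Longrightarrow> y $ i \<noteq> z" "y \<in> c" "y' \<in> c"
  shows "y $ i < z \<longleftrightarrow> y' $ i < z"
proof -
  have "\<exists>w\<in>c. w $ i = z" if "a \<in> c" "b \<in> c" "a $ i < z" "\<not> b $ i < z" for a b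
    using connected_ivt_component_cart[OF assms(1) that(1,2), of i z] that(3,4) by auto
  then show ?thesis using assms(2-4) by blast
qed

theorem theorem7:
  fixes n k :: nat
    and \<mu> :: "nat \<Rightarrow> (real ^ 'd) measure"
    and m :: "'d \<Rightarrow> nat"
  assumes "n \<ge> 1" and "k \<ge> 2"
    and "\<And>i. i \<in> {1..n} \<Longrightarrow> continuous_prob_measure (\<mu> i)"
    and "(\<Sum>i\<in>UNIV. m i) = n * (k - 1)"
  shows "\<exists>(X :: (real ^ 'd) set set) (Xs :: 'd \<Rightarrow> (real ^ 'd) set set).
    X = (\<Union>i. Xs i) \<and> finite X \<and> card X = n * (k - 1) \<and>
    (\<forall>H\<in>X. hyperplane H \<and> H \<inter> unit_cube \<noteq> {}) \<and>
    (\<forall>i. card (Xs i) = m i \<and> (\<forall>H\<in>Xs i. perpendicular H (axis i 1))) \<and>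
    (\<exists>\<omega> \<in> cells X \<rightarrow> {1..k}.
       \<forall>i\<in>{1..n}. \<forall>j\<in>{1..k}. measure (\<mu> i) (colored_region X \<omega> j) = 1 / real k)"
proof -
  define Q where "Q = (\<lambda>i f. integrable lebesgue f \<and> (\<forall>y. y \<notin> unit_cube \<longrightarrow> f y = 0) \<and>
    (LINT y|lebesgue. f y) = 1 \<and> (\<forall>A. A \<in> sets lebesgue \<longrightarrow> A \<subseteq> unit_cube \<longrightarrow>
      measure (\<mu> i) A = (LINT y|lebesgue. f y * indicator A y)))"
  have "\<forall>i\<in>{1..n}. \<exists>f. Q i f"
  proof
    fix i assume "i \<in> {1..n}"
    from assms(3)[OF this] show "\<exists>f. Q i f"
      by (rule continuous_prob_measure_density) (auto simp: Q_def)
  qed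
  then obtain f where f: "\<forall>i\<in>{1..n}. Q i (f i)" by (auto simp: bchoice_iff)
  obtain ds where ds: "length ds = (\<Sum>i\<in>UNIV. m i)" "\<And>i. count_list ds i = m i"
    using ex_list_count[of m] by blast
  \<comment> \<open>The given measures are numbered from 1, those of \<open>densities\<close> from
    0.\<close>
  have "densities n (\<lambda>i. f (Suc i))" using f unfolding densities_def Q_def by auto
  then have "\<exists>Z col. split_by Z col (\<lambda>i. f (Suc i)) n k ds"
    using assms(2,4) ds(1) by (intro split_general) auto
  then obtain Z0 col where Z0: "\<forall>i. finite (Z0 i) \<and> Z0 i \<subseteq> {0..1} \<and> card (Z0 i) \<le> m i"
    and det0: "determined Z0 col" and col: "\<forall>y. col y < k"
    and eq: "\<forall>i<n. \<forall>j<k. (LINT y|lebesgue. f (Suc i) y * indicator {y \<in> unit_cube. col y = j} y) =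
      (LINT y|lebesgue. f (Suc i) y) / k"
    unfolding split_by_def ds(2) by blast
  have "\<exists>W. Z0 i \<subseteq> W \<and> W \<subseteq> {0..1} \<and> finite W \<and> card W = m i" for i
  proof -
    have "infinite ({0..1} - Z0 i)" using Z0 infinite_Icc[of 0 "1 :: real"] by (intro Diff_infinite_finite) auto
    then obtain B where B: "finite B" "card B = m i - card (Z0 i)" "B \<subseteq> {0..1} - Z0 i"
      using infinite_arbitrarily_large by blast
    then have "card (Z0 i \<union> B) = m i" using Z0 by (subst card_Un_disjoint) auto
    then show ?thesis using B Z0 by (intro exI[of _ "Z0 i \<union> B"]) auto
  qed
  then obtain Z where Z: "\<forall>i. Z0 i \<subseteq> Z i \<and> Z i \<subseteq> {0..1} \<and> finite (Z i) \<and> card (Z i) = m i"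
    by metis
  have det: "determined Z col"
    unfolding determined_def
  proof (intro ballI impI)
    fix y y' :: "real ^ 'd" assume y: "y \<in> unit_cube" "y' \<in> unit_cube"
      and same: "\<forall>i. \<forall>z\<in>Z i. (y $ i < z) = (y' $ i < z)"
    have "\<forall>i. \<forall>z\<in>Z0 i. (y $ i < z) = (y' $ i < z)" using same Z by blast
    then show "col y = col y'" using det0 y unfolding determined_def by blast
  qed
  define H where "H = (\<lambda>i z. {y :: real ^ 'd. y $ i = z})"
  define Xs where "Xs = (\<lambda>i. H i ` Z i)"
  define X where "X = (\<Union>i. Xs i)"
  have H_eq: "i = i' \<and> z = z'" if "H i z = H i' z'" for i i' z z'
  proof -
    \<comment> \<open>If \<open>i\<close> and \<open>i'\<close> differed, the \<open>i'\<close>-th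
      coordinate of this point would be \<open>z' + 1\<close>, so it could not lie in
      \<open>H i' z'\<close>.\<close>
    have "(\<chi> j. if j = i then z else z' + 1) \<in> H i' z'"
      unfolding that[symmetric] by (simp add: H_def)
    then have "i = i'" by (simp add: H_def split: if_splits)
    moreover have "(\<chi> j. z) \<in> H i' z'" unfolding that[symmetric] by (simp add: H_def)
    ultimately show ?thesis by (simp add: H_def)
  qed
  have card_Xs: "card (Xs i) = m i" for i
    unfolding Xs_def using Z H_eq by (subst card_image) (auto intro!: inj_onI)
  have fin_Xs: "finite (Xs i)" for i using Z unfolding Xs_def by blast
  have "card X = (\<Sum>i\<in>UNIV. card (Xs i))"
    unfolding X_def using fin_Xs H_eq by (intro card_UN_disjoint) (auto simp: Xs_def)
  then have card_X: "card X = n * (k - 1)" using card_Xs assms(4) by simp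
  have fin_X: "finite X" unfolding X_def using fin_Xs by simp
  have hyper: "hyperplane (H i z)" for i z
    unfolding hyperplane_def H_def by (intro exI[of _ "axis i 1"] exI[of _ z]) (simp add: inner_axis' axis_eq_0_iff)
  have perp: "perpendicular (H i z) (axis i 1)" for i z
    unfolding perpendicular_def H_def orthogonal_def by (simp add: inner_axis)
  have meets: "H i z \<inter> unit_cube \<noteq> {}" if "z \<in> Z i" for i z
  proof -
    have "z \<in> {0..1}" using Z that by blast
    then have "(\<chi> j. z) \<in> H i z \<inter> unit_cube" by (simp add: H_def mem_unit_cube)
    then show ?thesis by blast
  qed
  have in_X: "y \<in> \<Union>X \<longleftrightarrow> (\<exists>i. y $ i \<in> Z i)" for y
    unfolding X_def Xs_def H_def by auto
  have col_cell: "col y = col y'" if c: "c \<in> cells X" "y \<in> c" "y' \<in> c" for c y y'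
  proof -
    have sub: "c \<subseteq> unit_cube - \<Union>X" and conn: "connected c"
      using c(1) unfolding cells_def by (auto dest: in_components_subset in_components_connected)
    have "\<forall>i. \<forall>z\<in>Z i. (y $ i < z) = (y' $ i < z)"
    proof (intro allI ballI)
      fix i z assume "z \<in> Z i"
      then have "w $ i \<noteq> z" if "w \<in> c" for w using in_X[of w] sub that by blast
      then show "(y $ i < z) = (y' $ i < z)" by (intro connected_same_side[OF conn _ c(2,3)])
    qed
    then show ?thesis using det sub c unfolding determined_def by blast
  qed
  \<comment> \<open>By \<open>col_cell\<close> any point of a cell gives its colour;
    \<open>Suc\<close> moves the colours from \<open>{..<k}\<close> to
    \<open>{1..k}\<close>.\<close>
  define \<omega> where "\<omega> = (\<lambda>c. Suc (col (SOME y. y \<in> c)))"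
  have \<omega>: "\<omega> c = Suc (col y)" if "c \<in> cells X" "y \<in> c" for c y
    unfolding \<omega>_def using col_cell[OF that(1) someI[of "\<lambda>y. y \<in> c", OF that(2)] that(2)] by simp
  have region: "colored_region X \<omega> (Suc j) = {y \<in> unit_cube. col y = j} - \<Union>X" for j
  proof (intro equalityI subsetI)
    fix y assume "y \<in> colored_region X \<omega> (Suc j)"
    then obtain c where c: "c \<in> cells X" "\<omega> c = Suc j" "y \<in> c" unfolding colored_region_def by blast
    then have "y \<in> unit_cube - \<Union>X" unfolding cells_def using in_components_subset by blast
    then show "y \<in> {y \<in> unit_cube. col y = j} - \<Union>X" using \<omega>[OF c(1,3)] c(2) by simp
  next
    fix y assume y: "y \<in> {y \<in> unit_cube. col y = j} - \<Union>X"
    then have "y \<in> \<Union>(components (unit_cube - \<Union>X))" by (simp only: Union_components) blast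
    then obtain c where c: "c \<in> cells X" "y \<in> c" unfolding cells_def by blast
    then have "\<omega> c = Suc j" using \<omega>[OF c] y by simp
    then show "y \<in> colored_region X \<omega> (Suc j)" using c unfolding colored_region_def by blast
  qed
  have meas: "measure (\<mu> i) (colored_region X \<omega> j) = 1 / real k" if i: "i \<in> {1..n}" and j: "j \<in> {1..k}" for i j
  proof -
    obtain i' j' where i': "i = Suc i'" "i' < n" and j': "j = Suc j'" "j' < k"
      using i j by (cases i; cases j) auto
    let ?A = "{y \<in> unit_cube. col y = j'}"
    have A: "?A \<in> sets lebesgue" using Z by (intro sets_determined[OF _ det]) blast
    have closed_H: "closed (H i z)" for i z
      unfolding H_def by (intro closed_Collect_eq continuous_intros)
    then have "closed (\<Union>X)"
      using fin_X by (intro closed_Union) (auto simp: X_def Xs_def)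
    then have "\<Union>X \<in> sets lebesgue" by (simp add: borel_closed)
    then have B: "?A - \<Union>X \<in> sets lebesgue" using A by (rule sets.Diff[rotated])
    have Qi: "Q i (f i)" using f i by blast
    \<comment> \<open>Points on the hyperplanes belong to no cell, and almost every point avoids
      them.\<close>
    have "AE y in lebesgue. \<forall>(i, z)\<in>(SIGMA i:UNIV. Z i). (y :: real ^ 'd) $ i \<noteq> z"
      using Z by (intro AE_finite_allI finite_SigmaI) (auto intro: AE_coordinate_neq)
    then have ae: "AE y in lebesgue. f i y * indicator (?A - \<Union>X) y = f i y * indicator ?A y"
    proof eventually_elim
      case (elim y)
      then have "y \<notin> \<Union>X" unfolding in_X by auto
      then show ?case by (simp add: indicator_def)
    qed
    have "measure (\<mu> i) (colored_region X \<omega> j) = (LINT y|lebesgue. f i y * indicator (?A - \<Union>X) y)"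
      using Qi B unfolding Q_def j'(1) region by blast
    also have "\<dots> = (LINT y|lebesgue. f i y * indicator ?A y)"
      using Qi A B ae unfolding Q_def
      by (intro integral_cong_AE borel_measurable_integrable integrable_indicator_mult) auto
    also have "\<dots> = (LINT y|lebesgue. f i y) / k"
      using eq i'(2) j'(2) unfolding i'(1) by blast
    also have "\<dots> = 1 / real k" using Qi unfolding Q_def by simp
    finally show ?thesis .
  qed
  have "\<omega> \<in> cells X \<rightarrow> {1..k}"
    using col unfolding \<omega>_def by (auto simp: Suc_le_eq)
  then have "\<exists>\<omega> \<in> cells X \<rightarrow> {1..k}.
      \<forall>i\<in>{1..n}. \<forall>j\<in>{1..k}. measure (\<mu> i) (colored_region X \<omega> j) = 1 / real k"
    using meas by blast
  moreover have "\<forall>H\<in>X. hyperplane H \<and> H \<inter> unit_cube \<noteq> {}"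
    using hyper meets unfolding X_def Xs_def by blast
  moreover have "\<forall>i. card (Xs i) = m i \<and> (\<forall>H\<in>Xs i. perpendicular H (axis i 1))"
    using card_Xs perp unfolding Xs_def by blast
  ultimately show ?thesis
    using fin_X card_X X_def by (intro exI[of _ X] exI[of _ Xs]) blast
qed

end
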